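(* Let $H$ be a complex Hilbert space and let $S\in\mathbf{B}(\ell^{2}(\mathbb{N},H))$ be a unilateral weighted shift with invertible weights $(S_{j})_{j\in\mathbb{Z}_{1}}\subset\mathbf{B}(H)$. For $m\in\mathbb{Z}_{1}$ the following conditions are equivalent: (i) $S$ is $m$-isometric; (ii) for every $x\in H$, $x\neq 0$, the classical (scalar) unilateral weighted shift $S_{x}\in\mathbf{B}(\ell^{2}(\mathbb{N},\mathbb{C}))$ with weights $(\alpha_{j}(x))_{j\in\mathbb{Z}_{1}}\subset(0,\infty)$ given by $\alpha_{1}(x)=\lVert S_{1}x\rVert$ and $\alpha_{j}(x)=\dfrac{\lVert S_{j}\cdots S_{1}x\rVert}{\lVert S_{j-1}\cdots S_{1}x\rVert}$ for $j\ge 2$, is $m$-isometric; (iii) there exists a polynomial $p\in\mathbf{B}(H)_{m-1}[z]$ such that $p(0)=I$ and $p(n)=\lvert S_{n}\cdots S_{1}\rvert^{2}$ for every $n\in\mathbb{Z}_{1}$. Moreover, if (iii) holds (with polynomial $p$), then $$\lVert S\rVert^{2}=\sup\left\{\frac{\langle p(n+1)h,h\rangle}{\langle p(n)h,h\rangle}: n\in\mathbb{N},\ h\in H,\ h\neq 0\right\}.$$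
   Context: $\mathbb{N}$ is the set of non-negative integers and $\mathbb{Z}_{p}=\{n\in\mathbb{Z}: n\ge p\}$. $\mathbf{B}(H)$ is the algebra of bounded linear operators on a complex Hilbert space $H$; invertible means invertible in $\mathbf{B}(H)$; $\lvert T\rvert=(T^{*}T)^{1/2}$. $\ell^{2}(\mathbb{N},H)$ is the Hilbert space of square-summable sequences $(h_{i})_{i\in\mathbb{N}}$ in $H$. For a uniformly bounded sequence $(S_{i})_{i\in\mathbb{Z}_{1}}\subset\mathbf{B}(H)$, the unilateral weighted shift $S$ with weights $(S_{i})_{i\in\mathbb{Z}_{1}}$ is the bounded operator on $\ell^{2}(\mathbb{N},H)$ given by $S(h_{0},h_{1},\ldots)=(0,S_{1}h_{0},S_{2}h_{1},\ldots)$; the classical case is $H=\mathbb{C}$ with scalar weights. A bounded operator $T$ is $m$-isometric ($m\in\mathbb{Z}_{1}$) if $\sum_{k=0}^{m}\binom{m}{k}(-1)^{m-k}T^{*k}T^{k}=0$. $\mathbf{B}(H)_{n}[z]$ denotes the space of polynomials $p(z)=\sum_{j=0}^{n}A_{j}z^{j}$ with coefficients $A_{j}\in\mathbf{B}(H)$ (degree at most $n$), evaluated at scalars $z\in\mathbb{C}$. Suprema are taken in $[0,\infty]$.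
   Formalization: In (ii) the first weight is taken as α₁(x)=‖S₁x‖/‖x‖ instead of ‖S₁x‖ (the two agree for unit x); as printed, (i)⇒(ii) fails, e.g. m=1, S_j=I, ‖x‖=2 gives weights 2,1,1,…. *)

theory Defs
  imports "HOL-Analysis.Analysis"
begin

section \<open>Complex Hilbert spaces\<close>

class complex_vector = real_vector +
  fixes scaleC :: "complex \<Rightarrow> 'a \<Rightarrow> 'a" (infixr "*\<^sub>C" 75)
  assumes scaleC_add_right: "a *\<^sub>C (x + y) = a *\<^sub>C x + a *\<^sub>C y"
    and scaleC_add_left: "(a + b) *\<^sub>C x = a *\<^sub>C x + b *\<^sub>C x"
    and scaleC_scaleC: "a *\<^sub>C b *\<^sub>C x = (a * b) *\<^sub>C x"
    and scaleC_of_real: "complex_of_real r *\<^sub>C x = r *\<^sub>R x"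

text \<open>The inner product is linear in its first argument. Positive definiteness is part of
  \<open>cinner_self\<close>, since the norm is positive definite.\<close>

class complex_inner = complex_vector + real_normed_vector +
  fixes cinner :: "'a \<Rightarrow> 'a \<Rightarrow> complex"
  assumes cinner_commute: "cinner x y = cnj (cinner y x)"
    and cinner_add_left: "cinner (x + y) z = cinner x z + cinner y z"
    and cinner_scaleC_left: "cinner (a *\<^sub>C x) y = a * cinner x y"
    and cinner_self: "cinner x x = complex_of_real ((norm x)\<^sup>2)"

class complex_hilbert = complex_inner + complete_space

instantiation complex :: complex_hilbert
begin
definition "scaleC_complex (a::complex) (x::complex) = a * x"
definition "cinner_complex (x::complex) (y::complex) = x * cnj y"
instance
  by standard (auto simp: scaleC_complex_def cinner_complex_def algebra_simps scaleR_conv_of_real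
      complex_norm_square simp flip: of_real_power)
end

lemma norm_scaleC: "norm (a *\<^sub>C x) = cmod a * norm (x :: 'a::complex_inner)"
proof -
  have "complex_of_real ((norm (a *\<^sub>C x))\<^sup>2) = a * cnj (cinner (a *\<^sub>C x) x)"
    by (metis cinner_self cinner_scaleC_left cinner_commute)
  also have "\<dots> = complex_of_real ((cmod a * norm x)\<^sup>2)"
    unfolding cinner_scaleC_left cinner_self
    unfolding of_real_power[symmetric] power_mult_distrib of_real_mult complex_norm_square
    by (simp add: mult.assoc)
  finally have "(norm (a *\<^sub>C x))\<^sup>2 = (cmod a * norm x)\<^sup>2"
    using of_real_eq_iff by blast
  then show ?thesis
    by (metis norm_ge_zero power2_eq_iff_nonneg mult_nonneg_nonneg)
qed

lemma cinner_add_right: "cinner x (y + z) = cinner x y + cinner x (z :: 'a::complex_inner)"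
  by (metis cinner_add_left cinner_commute complex_cnj_add)

lemma Re_cinner_le: "Re (cinner x y) \<le> norm x * norm (y :: 'a::complex_inner)"
proof -
  have "complex_of_real ((norm (x + y))\<^sup>2) = cinner x x + cinner y y + cinner x y + cinner y x"
    unfolding cinner_self[symmetric] by (simp add: cinner_add_left cinner_add_right)
  then have "(norm (x + y))\<^sup>2 = (norm x)\<^sup>2 + (norm y)\<^sup>2 + Re (cinner x y) + Re (cinner y x)"
    unfolding cinner_self by (metis Re_complex_of_real plus_complex.sel(1))
  moreover have "Re (cinner y x) = Re (cinner x y)"
    by (subst cinner_commute) simp
  moreover have "(norm (x + y))\<^sup>2 \<le> (norm x + norm y)\<^sup>2"
    by (simp add: norm_triangle_ineq power_mono)
  ultimately show ?thesis
    by (simp add: power2_eq_square algebra_simps)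
qed

lemma norm_cinner_le: "cmod (cinner x y) \<le> norm x * norm (y :: 'a::complex_inner)"
proof -
  define c where "c = cnj (sgn (cinner x y))"
  have "cmod c \<le> 1" by (simp add: c_def norm_sgn)
  have "c * cinner x y = complex_of_real (cmod (cinner x y))"
    by (cases "cinner x y = 0")
      (simp_all add: c_def sgn_eq mult.commute complex_norm_square[symmetric] power2_eq_square)
  then have "cmod (cinner x y) = Re (cinner (c *\<^sub>C x) y)"
    by (simp add: cinner_scaleC_left)
  also have "\<dots> \<le> cmod c * norm x * norm y"
    using Re_cinner_le[of "c *\<^sub>C x" y] by (simp add: norm_scaleC)
  also have "\<dots> \<le> norm x * norm y"
    using \<open>cmod c \<le> 1\<close> by (simp add: mult_left_le_one_le mult_right_mono)
  finally show ?thesis .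
qed


section \<open>The algebra of bounded operators\<close>

typedef (overloaded) 'a bop =
  "{T :: 'a::complex_inner \<Rightarrow>\<^sub>L 'a. \<forall>a x. blinfun_apply T (a *\<^sub>C x) = a *\<^sub>C blinfun_apply T x}"
  morphisms bop_blinfun Abs_bop
  by (rule exI[of _ id_blinfun]) auto

setup_lifting type_definition_bop

lift_definition bop_apply :: "'a::complex_inner bop \<Rightarrow> 'a \<Rightarrow> 'a" is blinfun_apply .

declare [[coercion bop_apply]]

lemma scaleC_scaleR: "a *\<^sub>C (r *\<^sub>R x) = r *\<^sub>R (a *\<^sub>C (x :: 'a::complex_vector))"
  by (metis scaleC_of_real scaleC_scaleC mult.commute)

lemma scaleC_zero_right: "a *\<^sub>C 0 = (0 :: 'a::complex_vector)"
  by (metis add_cancel_left_left scaleC_add_right)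

lemma scaleC_minus_right: "a *\<^sub>C (- x) = - (a *\<^sub>C (x :: 'a::complex_vector))"
  by (metis scaleC_scaleR scaleR_minus1_left)

lemma scaleC_diff_right: "a *\<^sub>C (x - y) = a *\<^sub>C x - a *\<^sub>C (y :: 'a::complex_vector)"
  by (metis scaleC_add_right diff_add_cancel add_diff_cancel)

lemma bounded_linear_scaleC: "bounded_linear (\<lambda>x :: 'a::complex_inner. a *\<^sub>C x)"
  by (rule bounded_linear_intro[where K = "cmod a"])
    (auto simp: scaleC_add_right scaleC_scaleR norm_scaleC)

lemma Blinfun_scaleC_apply:
  fixes T :: "'a::complex_inner \<Rightarrow>\<^sub>L 'a"
  shows "blinfun_apply (Blinfun (\<lambda>x. a *\<^sub>C blinfun_apply T x)) x = a *\<^sub>C blinfun_apply T x"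
  by (subst bounded_linear_Blinfun_apply)
    (rule bounded_linear_compose[OF bounded_linear_scaleC] blinfun.bounded_linear_right refl)+

text \<open>Multiplication is composition and \<open>1\<close> is the identity operator, so that
  \<open>T ^ k\<close> is the usual power. The norm is the operator norm.\<close>

instantiation bop :: (complex_inner) "{real_normed_algebra, monoid_mult, complex_vector}"
begin

lift_definition zero_bop :: "'a bop" is 0 by (simp add: scaleC_zero_right)
lift_definition one_bop :: "'a bop" is id_blinfun by simp
lift_definition plus_bop :: "'a bop \<Rightarrow> 'a bop \<Rightarrow> 'a bop" is "(+)"
  by (simp add: blinfun.add_left scaleC_add_right)
lift_definition minus_bop :: "'a bop \<Rightarrow> 'a bop \<Rightarrow> 'a bop" is "(-)"
  by (simp add: blinfun.diff_left scaleC_diff_right)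
lift_definition uminus_bop :: "'a bop \<Rightarrow> 'a bop" is uminus
  by (simp add: blinfun.minus_left scaleC_minus_right)
lift_definition times_bop :: "'a bop \<Rightarrow> 'a bop \<Rightarrow> 'a bop" is "(o\<^sub>L)" by simp
lift_definition scaleR_bop :: "real \<Rightarrow> 'a bop \<Rightarrow> 'a bop" is scaleR
  by (simp add: blinfun.scaleR_left scaleC_scaleR)
lift_definition scaleC_bop :: "complex \<Rightarrow> 'a bop \<Rightarrow> 'a bop"
  is "\<lambda>a T. Blinfun (\<lambda>x. a *\<^sub>C blinfun_apply T x)"
  by (simp add: Blinfun_scaleC_apply scaleC_scaleC mult.commute)
lift_definition norm_bop :: "'a bop \<Rightarrow> real" is norm .

definition "dist_bop (S :: 'a bop) T = norm (S - T)"
definition "sgn_bop (T :: 'a bop) = scaleR (inverse (norm T)) T"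
definition "uniformity_bop = (INF e\<in>{0<..}. principal {(S :: 'a bop, T). dist S T < e})"
definition "open_bop (U :: 'a bop set) \<longleftrightarrow>
  (\<forall>S\<in>U. eventually (\<lambda>(S', T). S' = S \<longrightarrow> T \<in> U) uniformity)"

instance
proof
  fix S T U :: "'a bop" and r s :: real and a b :: complex
  show "dist S T = norm (S - T)" by (rule dist_bop_def)
  show "sgn T = inverse (norm T) *\<^sub>R T" by (rule sgn_bop_def)
  show "uniformity = (INF e\<in>{0<..}. principal {(S :: 'a bop, T). dist S T < e})"
    by (rule uniformity_bop_def)
  show "open X \<longleftrightarrow> (\<forall>S\<in>X. eventually (\<lambda>(S', T). S' = S \<longrightarrow> T \<in> X) uniformity)"
    for X :: "'a bop set" by (rule open_bop_def)
  show "norm (S * T) \<le> norm S * norm T" by transfer (rule norm_blinfun_compose)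
  show "norm (S + T) \<le> norm S + norm T" by transfer (rule norm_triangle_ineq)
  show "norm T = 0 \<longleftrightarrow> T = 0" by transfer simp
  show "norm (r *\<^sub>R T) = \<bar>r\<bar> * norm T" by transfer simp
  show "a *\<^sub>C (S + T) = a *\<^sub>C S + a *\<^sub>C T"
    by (transfer, rule blinfun_eqI, subst Blinfun_scaleC_apply)
      (simp add: Blinfun_scaleC_apply blinfun.add_left scaleC_add_right)
  show "(a + b) *\<^sub>C T = a *\<^sub>C T + b *\<^sub>C T"
    by (transfer, rule blinfun_eqI, subst Blinfun_scaleC_apply)
      (simp add: Blinfun_scaleC_apply blinfun.add_left scaleC_add_left)
  show "a *\<^sub>C b *\<^sub>C T = (a * b) *\<^sub>C T"
    by transfer (auto intro!: blinfun_eqI simp: Blinfun_scaleC_apply scaleC_scaleC)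
  show "complex_of_real r *\<^sub>C T = r *\<^sub>R T"
    by (transfer, rule blinfun_eqI, subst Blinfun_scaleC_apply)
      (simp add: scaleC_of_real blinfun.scaleR_left)
qed (transfer; auto intro!: blinfun_eqI simp: blinfun.bilinear_simps algebra_simps)+

end

definition invertible_op :: "'a::complex_inner bop \<Rightarrow> bool" where
  "invertible_op T \<longleftrightarrow> (\<exists>U. U * T = 1 \<and> T * U = 1)"

definition adj :: "'a::complex_hilbert bop \<Rightarrow> 'a bop" where
  "adj T = (SOME U :: 'a bop. \<forall>x y. cinner (T x) y = cinner x (U y))"

definition positive_op :: "'a::complex_hilbert bop \<Rightarrow> bool" where
  "positive_op T \<longleftrightarrow> (\<forall>x. cinner (T x) x \<in> \<real>\<^sub>\<ge>\<^sub>0)"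

text \<open>Positive square roots of positive operators exist and are unique.\<close>

definition sqrt_op :: "'a::complex_hilbert bop \<Rightarrow> 'a bop" where
  "sqrt_op T = (SOME R. positive_op R \<and> R\<^sup>2 = T)"

definition abs_op :: "'a::complex_hilbert bop \<Rightarrow> 'a bop" where
  "abs_op T = sqrt_op (adj T * T)"

definition m_isometric :: "nat \<Rightarrow> 'a::complex_hilbert bop \<Rightarrow> bool" where
  "m_isometric m T \<longleftrightarrow>
    (\<Sum>k\<le>m. (real (m choose k) * (-1) ^ (m - k)) *\<^sub>R (adj T ^ k * T ^ k)) = 0"

definition op_polys :: "nat \<Rightarrow> (complex \<Rightarrow> 'a::complex_inner bop) set" where
  "op_polys n = {p. \<exists>A. \<forall>z. p z = (\<Sum>j\<le>n. z ^ j *\<^sub>C A j)}"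


section \<open>Square-summable sequences\<close>

typedef (overloaded) 'a ell2 =
  "{f :: nat \<Rightarrow> 'a::complex_inner. summable (\<lambda>i. (norm (f i))\<^sup>2)}"
  morphisms ell2_nth Abs_ell2
  by (rule exI[of _ "\<lambda>_. 0"]) auto

setup_lifting type_definition_ell2

lemma ell2_summable: "summable (\<lambda>i. (norm (ell2_nth f i))\<^sup>2)"
  using ell2_nth by blast

lemma sum_sq_le: "(a + b)\<^sup>2 \<le> 2 * a\<^sup>2 + 2 * (b::real)\<^sup>2"
  using sum_squares_bound[of a b] by (simp add: power2_sum)

lemma summable_sq_add:
  fixes f g :: "nat \<Rightarrow> 'a::real_normed_vector"
  assumes "summable (\<lambda>i. (norm (f i))\<^sup>2)" "summable (\<lambda>i. (norm (g i))\<^sup>2)"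
  shows "summable (\<lambda>i. (norm (f i + g i))\<^sup>2)"
proof (rule summable_comparison_test'[where N = 0])
  show "summable (\<lambda>i. 2 * (norm (f i))\<^sup>2 + 2 * (norm (g i))\<^sup>2)"
    using assms by (intro summable_add summable_mult)
  show "norm ((norm (f i + g i))\<^sup>2) \<le> 2 * (norm (f i))\<^sup>2 + 2 * (norm (g i))\<^sup>2" for i
    using order.trans[OF power_mono[OF norm_triangle_ineq norm_ge_zero] sum_sq_le, of "f i" "g i"]
    by simp
qed

lemma summable_cinner:
  fixes f g :: "nat \<Rightarrow> 'a::complex_inner"
  assumes "summable (\<lambda>i. (norm (f i))\<^sup>2)" "summable (\<lambda>i. (norm (g i))\<^sup>2)"
  shows "summable (\<lambda>i. cinner (f i) (g i))"
proof (rule summable_comparison_test'[where N = 0])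
  show "summable (\<lambda>i. (norm (f i))\<^sup>2 + (norm (g i))\<^sup>2)"
    using assms by (rule summable_add)
  show "norm (cinner (f i) (g i)) \<le> (norm (f i))\<^sup>2 + (norm (g i))\<^sup>2" for i
  proof -
    have "norm (f i) * norm (g i) \<le> (norm (f i))\<^sup>2 + (norm (g i))\<^sup>2"
      using sum_squares_bound[of "norm (f i)" "norm (g i)"]
        mult_nonneg_nonneg[OF norm_ge_zero norm_ge_zero, of "f i" "g i"] by linarith
    then show ?thesis using norm_cinner_le order.trans by blast
  qed
qed

instantiation ell2 :: (complex_inner) complex_inner
begin

lift_definition zero_ell2 :: "'a ell2" is "\<lambda>_. 0" by simp
lift_definition plus_ell2 :: "'a ell2 \<Rightarrow> 'a ell2 \<Rightarrow> 'a ell2" is "\<lambda>f g i. f i + g i"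
  by (rule summable_sq_add)
lift_definition uminus_ell2 :: "'a ell2 \<Rightarrow> 'a ell2" is "\<lambda>f i. - f i" by simp
lift_definition minus_ell2 :: "'a ell2 \<Rightarrow> 'a ell2 \<Rightarrow> 'a ell2" is "\<lambda>f g i. f i - g i"
  using summable_sq_add[of _ "\<lambda>i. - _ i"] by fastforce
lift_definition scaleR_ell2 :: "real \<Rightarrow> 'a ell2 \<Rightarrow> 'a ell2" is "\<lambda>r f i. r *\<^sub>R f i"
  by (simp add: power_mult_distrib summable_mult)
lift_definition scaleC_ell2 :: "complex \<Rightarrow> 'a ell2 \<Rightarrow> 'a ell2" is "\<lambda>a f i. a *\<^sub>C f i"
  by (simp add: norm_scaleC power_mult_distrib summable_mult)
lift_definition cinner_ell2 :: "'a ell2 \<Rightarrow> 'a ell2 \<Rightarrow> complex" is "\<lambda>f g. \<Sum>i. cinner (f i) (g i)" .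
lift_definition norm_ell2 :: "'a ell2 \<Rightarrow> real" is "\<lambda>f. sqrt (\<Sum>i. (norm (f i))\<^sup>2)" .

definition "dist_ell2 (f :: 'a ell2) g = norm (f - g)"
definition "sgn_ell2 (f :: 'a ell2) = scaleR (inverse (norm f)) f"
definition "uniformity_ell2 = (INF e\<in>{0<..}. principal {(f :: 'a ell2, g). dist f g < e})"
definition "open_ell2 (U :: 'a ell2 set) \<longleftrightarrow>
  (\<forall>f\<in>U. eventually (\<lambda>(f', g). f' = f \<longrightarrow> g \<in> U) uniformity)"

instance
proof
  fix f g h :: "'a ell2" and r s :: real and a b :: complex
  show "dist f g = norm (f - g)" by (rule dist_ell2_def)
  show "sgn f = inverse (norm f) *\<^sub>R f" by (rule sgn_ell2_def)
  show "uniformity = (INF e\<in>{0<..}. principal {(f :: 'a ell2, g). dist f g < e})"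
    by (rule uniformity_ell2_def)
  show "open X \<longleftrightarrow> (\<forall>f\<in>X. eventually (\<lambda>(f', g). f' = f \<longrightarrow> g \<in> X) uniformity)"
    for X :: "'a ell2 set" by (rule open_ell2_def)
  show "norm f = 0 \<longleftrightarrow> f = 0"
    by transfer (auto simp: suminf_eq_zero_iff)
  show "norm (r *\<^sub>R f) = \<bar>r\<bar> * norm f"
    by transfer (simp add: power_mult_distrib suminf_mult real_sqrt_mult)
  show "norm (f + g) \<le> norm f + norm g"
  proof transfer
    fix f g :: "nat \<Rightarrow> 'a"
    assume f: "summable (\<lambda>i. (norm (f i))\<^sup>2)" and g: "summable (\<lambda>i. (norm (g i))\<^sup>2)"
    let ?n = "\<lambda>f :: nat \<Rightarrow> 'a. sqrt (\<Sum>i. (norm (f i))\<^sup>2)"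
    have "(\<lambda>k. L2_set (\<lambda>i. norm (f i + g i)) {..<k}) \<longlonglongrightarrow> ?n (\<lambda>i. f i + g i)"
      unfolding L2_set_def
      by (intro tendsto_real_sqrt summable_LIMSEQ summable_sq_add f g)
    moreover have "L2_set (\<lambda>i. norm (f i + g i)) {..<k} \<le> ?n f + ?n g" for k
    proof -
      have "L2_set (\<lambda>i. norm (f i + g i)) {..<k} \<le> L2_set (\<lambda>i. norm (f i) + norm (g i)) {..<k}"
        by (intro L2_set_mono norm_triangle_ineq norm_ge_zero)
      also have "\<dots> \<le> L2_set (\<lambda>i. norm (f i)) {..<k} + L2_set (\<lambda>i. norm (g i)) {..<k}"
        by (rule L2_set_triangle_ineq)
      also have "\<dots> \<le> ?n f + ?n g"
        unfolding L2_set_def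
        by (intro add_mono real_sqrt_le_mono sum_le_suminf f g) auto
      finally show ?thesis .
    qed
    ultimately show "?n (\<lambda>i. f i + g i) \<le> ?n f + ?n g"
      by (blast intro: LIMSEQ_le_const2)
  qed
  show "cinner f g = cnj (cinner g f)"
  proof transfer
    fix f g :: "nat \<Rightarrow> 'a"
    assume f: "summable (\<lambda>i. (norm (f i))\<^sup>2)" and g: "summable (\<lambda>i. (norm (g i))\<^sup>2)"
    have "(\<lambda>i. cinner (g i) (f i)) sums (\<Sum>i. cinner (g i) (f i))"
      using summable_cinner[OF g f] by (rule summable_sums)
    then have "(\<lambda>i. cnj (cinner (g i) (f i))) sums cnj (\<Sum>i. cinner (g i) (f i))"
      by (simp add: sums_cnj)
    then show "(\<Sum>i. cinner (f i) (g i)) = cnj (\<Sum>i. cinner (g i) (f i))"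
      by (simp add: sums_iff flip: cinner_commute)
  qed
  show "cinner (f + g) h = cinner f h + cinner g h"
    by transfer (simp add: cinner_add_left suminf_add summable_cinner)
  show "cinner (a *\<^sub>C f) g = a * cinner f g"
    by transfer (simp add: cinner_scaleC_left suminf_mult summable_cinner)
  show "cinner f f = complex_of_real ((norm f)\<^sup>2)"
    by transfer (simp add: cinner_self suminf_of_real suminf_nonneg flip: of_real_power)
qed (transfer; auto simp: algebra_simps scaleC_add_right scaleC_add_left scaleC_scaleC scaleC_of_real)+

end

lemma norm_ell2_nth_le: "norm (ell2_nth f i) \<le> norm f"
proof -
  have "(norm (ell2_nth f i))\<^sup>2 \<le> (\<Sum>i. (norm (ell2_nth f i))\<^sup>2)"
    using sum_le_suminf[OF ell2_summable, of "{i}" f] by simp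
  then show ?thesis
    by (simp add: norm_ell2.rep_eq real_le_rsqrt)
qed

instance ell2 :: (complex_hilbert) complex_hilbert
proof
  fix X :: "nat \<Rightarrow> 'a ell2"
  assume X: "Cauchy X"
  have nth_diff: "ell2_nth (f - g) i = ell2_nth f i - ell2_nth g i" for f g :: "'a ell2" and i
    by transfer simp
  have "Cauchy (\<lambda>n. ell2_nth (X n) i)" for i
  proof (rule metric_CauchyI)
    fix e :: real assume "0 < e"
    then obtain M where M: "\<And>m n. m \<ge> M \<Longrightarrow> n \<ge> M \<Longrightarrow> dist (X m) (X n) < e"
      using X unfolding Cauchy_def by blast
    show "\<exists>M. \<forall>m\<ge>M. \<forall>n\<ge>M. dist (ell2_nth (X m) i) (ell2_nth (X n) i) < e"
    proof (intro exI[of _ M] allI impI)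
      fix m n assume "m \<ge> M" "n \<ge> M"
      then show "dist (ell2_nth (X m) i) (ell2_nth (X n) i) < e"
        using norm_ell2_nth_le[of "X m - X n" i] M[of m n] by (simp add: dist_norm nth_diff)
    qed
  qed
  then have "\<forall>i. \<exists>l. (\<lambda>n. ell2_nth (X n) i) \<longlonglongrightarrow> l"
    by (simp add: Cauchy_convergent flip: convergent_def)
  then obtain l where l: "\<And>i. (\<lambda>n. ell2_nth (X n) i) \<longlonglongrightarrow> l i" by metis
  have key: "\<exists>M. \<forall>m\<ge>M. \<forall>k. (\<Sum>i<k. (norm (ell2_nth (X m) i - l i))\<^sup>2) \<le> e\<^sup>2" if "e > 0" for e
  proof -
    obtain M where M: "\<And>m n. m \<ge> M \<Longrightarrow> n \<ge> M \<Longrightarrow> dist (X m) (X n) < e"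
      using X \<open>e > 0\<close> unfolding Cauchy_def by blast
    have "(\<Sum>i<k. (norm (ell2_nth (X m) i - l i))\<^sup>2) \<le> e\<^sup>2" if "m \<ge> M" for m k
    proof (rule LIMSEQ_le_const2)
      show "(\<lambda>n. \<Sum>i<k. (norm (ell2_nth (X m) i - ell2_nth (X n) i))\<^sup>2)
          \<longlonglongrightarrow> (\<Sum>i<k. (norm (ell2_nth (X m) i - l i))\<^sup>2)"
        by (intro tendsto_intros l)
      have "(\<Sum>i<k. (norm (ell2_nth (X m) i - ell2_nth (X n) i))\<^sup>2) \<le> e\<^sup>2" if "n \<ge> M" for n
      proof -
        have "(\<Sum>i<k. (norm (ell2_nth (X m - X n) i))\<^sup>2) \<le> (\<Sum>i. (norm (ell2_nth (X m - X n) i))\<^sup>2)"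
          by (intro sum_le_suminf ell2_summable) auto
        also have "\<dots> = (norm (X m - X n))\<^sup>2"
          by (simp add: norm_ell2.rep_eq suminf_nonneg ell2_summable)
        also have "\<dots> \<le> e\<^sup>2"
          using M[OF \<open>m \<ge> M\<close> that] by (intro power_mono) (auto simp: dist_norm)
        finally show ?thesis by (simp add: nth_diff)
      qed
      then show "\<exists>N. \<forall>n\<ge>N. (\<Sum>i<k. (norm (ell2_nth (X m) i - ell2_nth (X n) i))\<^sup>2) \<le> e\<^sup>2"
        by blast
    qed
    then show ?thesis by blast
  qed
  have summ: "summable (\<lambda>i. (norm (ell2_nth (X m) i - l i))\<^sup>2)"
    if "\<forall>k. (\<Sum>i<k. (norm (ell2_nth (X m) i - l i))\<^sup>2) \<le> e\<^sup>2" for m e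
    using that by (intro summableI_nonneg_bounded[where x = "e\<^sup>2"]) auto
  have "summable (\<lambda>i. (norm (l i))\<^sup>2)"
  proof -
    obtain m where "\<forall>k. (\<Sum>i<k. (norm (ell2_nth (X m) i - l i))\<^sup>2) \<le> 1\<^sup>2"
      using key[of 1] by auto
    from summable_sq_add[OF summ[OF this, unfolded norm_minus_commute[of _ "l _"]] ell2_summable[of "X m"]]
    show ?thesis by simp
  qed
  then have nth_L: "ell2_nth (Abs_ell2 l) = l"
    by (simp add: Abs_ell2_inverse)
  have "X \<longlonglongrightarrow> Abs_ell2 l"
  proof (rule metric_LIMSEQ_I)
    fix e :: real assume "0 < e"
    then obtain M where M: "\<And>m k. m \<ge> M \<Longrightarrow> (\<Sum>i<k. (norm (ell2_nth (X m) i - l i))\<^sup>2) \<le> (e/2)\<^sup>2"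
      using key[of "e/2"] by auto
    have "dist (X m) (Abs_ell2 l) < e" if "m \<ge> M" for m
    proof -
      have "(\<Sum>i. (norm (ell2_nth (X m) i - l i))\<^sup>2) \<le> (e/2)\<^sup>2"
        using M[OF that] by (intro suminf_le_const summ) auto
      then have "norm (X m - Abs_ell2 l) \<le> e/2"
        unfolding norm_ell2.rep_eq nth_diff nth_L using \<open>0 < e\<close> by (intro real_le_lsqrt) auto
      then show ?thesis using \<open>0 < e\<close> by (simp add: dist_norm)
    qed
    then show "\<exists>M. \<forall>m\<ge>M. dist (X m) (Abs_ell2 l) < e" by blast
  qed
  then show "convergent X" by (auto simp: convergent_def)
qed


section \<open>Unilateral weighted shifts\<close>

text \<open>Weights are indexed from 1; the value \<open>W 0\<close> is irrelevant. For uniformly bounded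
  weights the operator exists and is unique, see \<open>weighted_shift_ex1\<close>.\<close>

definition is_weighted_shift :: "(nat \<Rightarrow> 'a::complex_hilbert bop) \<Rightarrow> 'a ell2 bop \<Rightarrow> bool" where
  "is_weighted_shift W S \<longleftrightarrow> (\<forall>h. ell2_nth (S h) 0 = 0 \<and>
     (\<forall>n. ell2_nth (S h) (Suc n) = W (Suc n) (ell2_nth h n)))"

definition weighted_shift :: "(nat \<Rightarrow> 'a::complex_hilbert bop) \<Rightarrow> 'a ell2 bop" where
  "weighted_shift W = (THE S. is_weighted_shift W S)"

text \<open>The classical case: the scalar weight \<open>\<alpha> j\<close> acts on the complex numbers by
  multiplication.\<close>

definition scalar_weighted_shift :: "(nat \<Rightarrow> real) \<Rightarrow> complex ell2 bop" where
  "scalar_weighted_shift \<alpha> = weighted_shift (\<lambda>j. \<alpha> j *\<^sub>R 1)"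

text \<open>\<open>shift_prod W n\<close> is the product \<open>W n * \<dots> * W 1\<close>.\<close>

primrec shift_prod :: "(nat \<Rightarrow> 'a::complex_inner bop) \<Rightarrow> nat \<Rightarrow> 'a bop" where
  "shift_prod W 0 = 1"
| "shift_prod W (Suc n) = W (Suc n) * shift_prod W n"

text \<open>For \<open>j = 1\<close> the empty product in the denominator makes the weight
  \<open>norm (W 1 x) / norm x\<close>, which is \<open>norm (W 1 x)\<close> for unit vectors \<open>x\<close>. The unnormalised first
  weight \<open>norm (W 1 x)\<close> would be wrong for other vectors: the shift with weights \<open>W j = 1\<close> is
  isometric, but the scalar weights \<open>2, 1, 1, \<dots>\<close> obtained from a vector of norm 2 do not
  give an isometry.\<close>

definition vector_weight :: "(nat \<Rightarrow> 'a::complex_inner bop) \<Rightarrow> 'a \<Rightarrow> nat \<Rightarrow> real" where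
  "vector_weight W x j = norm (shift_prod W j x) / norm (shift_prod W (j - 1) x)"

lemma bop_eqI: "(\<And>x. bop_apply S x = bop_apply T x) \<Longrightarrow> S = T"
  by transfer (auto intro: blinfun_eqI)

lemma norm_bop_apply: "norm (bop_apply T x) \<le> norm T * norm x"
  by transfer (rule norm_blinfun)

lemma times_bop_apply: "bop_apply (S * T) x = bop_apply S (bop_apply T x)"
  by transfer simp

lemma one_bop_apply: "bop_apply 1 x = x"
  by transfer simp

lemma bop_add: "bop_apply T (x + y) = bop_apply T x + bop_apply T y"
  by transfer (simp add: blinfun.add_right)

lemma bop_scaleC: "bop_apply T (a *\<^sub>C x) = a *\<^sub>C bop_apply T x"
  by transfer simp

lemma bop_scaleR: "bop_apply T (r *\<^sub>R x) = r *\<^sub>R bop_apply T x"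
  by transfer (simp add: blinfun.scaleR_right)

lemma bop_zero: "bop_apply T 0 = 0"
  by transfer simp

lemma bop_exI:
  fixes f :: "'a::complex_inner \<Rightarrow> 'a"
  assumes "\<And>x y. f (x + y) = f x + f y" "\<And>a x. f (a *\<^sub>C x) = a *\<^sub>C f x"
    and "\<And>x. norm (f x) \<le> norm x * K"
  shows "\<exists>T. bop_apply T = f"
proof -
  have "bounded_linear f"
    using assms by (intro bounded_linear_intro[where K = K]) (auto simp flip: scaleC_of_real)
  then have "blinfun_apply (Blinfun f) = f"
    by (rule bounded_linear_Blinfun_apply)
  with assms(2) have "bop_apply (Abs_bop (Blinfun f)) = f"
    by (simp add: bop_apply.rep_eq Abs_bop_inverse)
  then show ?thesis ..
qed

lemma weighted_shift_ex1:
  assumes "bounded (W ` {1..})"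
  shows "\<exists>!S. is_weighted_shift W S"
proof (rule ex_ex1I)
  obtain K where K: "\<And>j. j \<ge> 1 \<Longrightarrow> norm (W j) \<le> K" and "K \<ge> 0"
    using assms unfolding bounded_pos by (meson atLeast_iff imageI less_imp_le)
  define g where "g h i = (case i of 0 \<Rightarrow> 0 | Suc j \<Rightarrow> W (Suc j) (ell2_nth h j))" for h i
  define F where "F h = Abs_ell2 (g h)" for h
  have le: "(norm (g h (Suc i)))\<^sup>2 \<le> K\<^sup>2 * (norm (ell2_nth h i))\<^sup>2" for h i
  proof -
    have "norm (g h (Suc i)) \<le> K * norm (ell2_nth h i)"
      using norm_bop_apply[of "W (Suc i)" "ell2_nth h i"]
        mult_right_mono[OF K[of "Suc i"] norm_ge_zero[of "ell2_nth h i"]]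
      by (simp add: g_def)
    then show ?thesis
      by (metis norm_ge_zero power_mono power_mult_distrib)
  qed
  have summ: "summable (\<lambda>i. (norm (g h (Suc i)))\<^sup>2)" for h
    by (rule summable_comparison_test'[OF summable_mult[OF ell2_summable[of h], of "K\<^sup>2"], where N = 0])
      (use le in auto)
  then have summ': "summable (\<lambda>i. (norm (g h i))\<^sup>2)" for h
    using summable_Suc_iff by blast
  then have nth_F: "ell2_nth (F h) = g h" for h
    by (simp add: F_def Abs_ell2_inverse)
  have "norm (F h) \<le> norm h * K" for h
  proof -
    have "(\<Sum>i. (norm (g h i))\<^sup>2) = (\<Sum>i. (norm (g h (Suc i)))\<^sup>2)"
      using suminf_split_head[OF summ'[of h]] by (simp add: g_def)
    also have "\<dots> \<le> (\<Sum>i. K\<^sup>2 * (norm (ell2_nth h i))\<^sup>2)"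
      by (intro suminf_le le summ summable_mult ell2_summable)
    also have "\<dots> = (K * norm h)\<^sup>2"
      by (simp add: power_mult_distrib suminf_mult ell2_summable suminf_nonneg norm_ell2.rep_eq)
    finally have "sqrt (\<Sum>i. (norm (g h i))\<^sup>2) \<le> K * norm h"
      using \<open>K \<ge> 0\<close> by (intro real_le_lsqrt) auto
    then show ?thesis
      by (simp add: norm_ell2.rep_eq[of "F h"] nth_F mult.commute)
  qed
  moreover have "F (h + k) = F h + F k" for h k
    by (simp add: ell2_nth_inject[symmetric] nth_F plus_ell2.rep_eq fun_eq_iff g_def bop_add
        split: nat.split)
  moreover have "F (a *\<^sub>C h) = a *\<^sub>C F h" for a h
    by (simp add: ell2_nth_inject[symmetric] nth_F scaleC_ell2.rep_eq fun_eq_iff g_def bop_scaleC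
        scaleC_zero_right split: nat.split)
  ultimately obtain S where "bop_apply S = F"
    using bop_exI[of F K] by blast
  then have "is_weighted_shift W S"
    by (simp add: is_weighted_shift_def nth_F g_def)
  then show "\<exists>S. is_weighted_shift W S" ..
  show "S = T" if S: "is_weighted_shift W S" and T: "is_weighted_shift W T" for S T
  proof (rule bop_eqI)
    fix h
    have "ell2_nth (S h) n = ell2_nth (T h) n" for n
      using S T by (cases n) (auto simp: is_weighted_shift_def)
    then show "S h = T h" by (simp add: ell2_nth_inject[symmetric] fun_eq_iff)
  qed
qed

lemma is_weighted_shift_weighted_shift:
  "bounded (W ` {1..}) \<Longrightarrow> is_weighted_shift W (weighted_shift W)"
  unfolding weighted_shift_def by (rule theI') (rule weighted_shift_ex1)

lemma vector_weight_1:
  "norm x = 1 \<Longrightarrow> vector_weight W x 1 = norm (bop_apply (W 1) x)"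
  by (simp add: vector_weight_def times_bop_apply one_bop_apply)

lemma shift_prod_nonzero:
  assumes "\<And>j. j \<ge> 1 \<Longrightarrow> invertible_op (W j)" and "x \<noteq> 0"
  shows "shift_prod W n x \<noteq> 0"
proof (induction n)
  case (Suc n)
  obtain U where "U * W (Suc n) = 1"
    using assms(1)[of "Suc n"] by (auto simp: invertible_op_def)
  then have "U (W (Suc n) (shift_prod W n x)) = shift_prod W n x"
    by (metis times_bop_apply one_bop_apply)
  with Suc show ?case by (auto simp: times_bop_apply bop_zero)
qed (simp add: one_bop_apply assms)

lemma vector_weight_pos:
  assumes "\<And>j. j \<ge> 1 \<Longrightarrow> invertible_op (W j)" and "x \<noteq> 0"
  shows "vector_weight W x j > 0"
  using shift_prod_nonzero[OF assms] by (simp add: vector_weight_def)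

lemma bounded_vector_weight:
  assumes "bounded (W ` {1..})"
  shows "bounded ((\<lambda>j. vector_weight W x j *\<^sub>R (1 :: complex bop)) ` {1..})"
proof -
  obtain K where K: "\<And>j. j \<ge> 1 \<Longrightarrow> norm (W j) \<le> K" and "K \<ge> 0"
    using assms unfolding bounded_pos by (meson atLeast_iff imageI less_imp_le)
  have "norm (vector_weight W x j *\<^sub>R (1 :: complex bop)) \<le> K * norm (1 :: complex bop)" if j: "j \<ge> 1" for j
  proof -
    obtain i where i: "j = Suc i" using j by (cases j) auto
    have "norm (shift_prod W j x) \<le> K * norm (shift_prod W i x)"
      using norm_bop_apply[of "W j" "shift_prod W i x"]
        mult_right_mono[OF K[OF j] norm_ge_zero[of "shift_prod W i x"]]
      by (simp add: i times_bop_apply)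
    then have "vector_weight W x j \<le> K"
      using \<open>K \<ge> 0\<close> by (cases "shift_prod W i x = 0") (auto simp: vector_weight_def i divide_le_eq)
    moreover have "vector_weight W x j \<ge> 0" by (simp add: vector_weight_def)
    ultimately show ?thesis by (simp add: mult_right_mono)
  qed
  then show ?thesis unfolding bounded_iff by auto
qed

end

theory Submission
  imports Defs "HOL-Computational_Algebra.Formal_Power_Series"
begin

text \<open>Testing the defining identity of an \<open>m\<close>-isometry on \<open>h\<close> turns it into
  \<open>\<Sum>k\<le>m. (-1) ^ (m - k) * (m choose k) * (norm ((S ^ k) h))\<^sup>2 = 0\<close>. Write \<open>P n = W n * \<dots> * W 1\<close>.
  Since the weights are invertible, every \<open>h\<close> has entries \<open>P n (x n)\<close>, and the entries of
  \<open>(S ^ k) h\<close> are then \<open>P (n + k) (x n)\<close>. So \<open>S\<close> is \<open>m\<close>-isometric iff for every \<open>x\<close> the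
  \<open>m\<close>-th difference of \<open>n \<mapsto> (norm (P n x))\<^sup>2\<close> vanishes. Up to the factor \<open>(norm x)\<^sup>2\<close> this sequence
  is the same for the scalar shift \<open>S\<^sub>x\<close>, which gives (ii), and by Newton's forward formula its
  vanishing \<open>m\<close>-th difference means that the operators \<open>adj (P n) * P n\<close> interpolate to a polynomial
  of degree at most \<open>m - 1\<close>, which gives (iii).\<close>

section \<open>Adjoints of bounded operators\<close>

lemma cinner_scaleC_right: "cinner x (a *\<^sub>C y) = cnj a * cinner (x :: 'a::complex_inner) y"
  by (metis cinner_commute cinner_scaleC_left complex_cnj_mult)

lemma bounded_bilinear_cinner: "bounded_bilinear (cinner :: 'a::complex_inner \<Rightarrow> 'a \<Rightarrow> complex)"
proof
  fix x y :: 'a and r :: real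
  show "cinner (r *\<^sub>R x) y = r *\<^sub>R cinner x y"
    using cinner_scaleC_left[of "of_real r" x y] by (simp add: scaleC_of_real scaleR_conv_of_real)
  show "cinner x (r *\<^sub>R y) = r *\<^sub>R cinner x y"
    using cinner_scaleC_right[of x "of_real r" y] by (simp add: scaleC_of_real scaleR_conv_of_real)
  show "\<exists>K. \<forall>(x::'a) y. norm (cinner x y) \<le> norm x * norm y * K"
    using norm_cinner_le by (intro exI[of _ 1]) auto
qed (simp_all add: cinner_add_left cinner_add_right)

interpretation cinner: bounded_bilinear cinner
  by (rule bounded_bilinear_cinner)

lemma bounded_bilinear_bop_apply: "bounded_bilinear (bop_apply :: 'a::complex_inner bop \<Rightarrow> 'a \<Rightarrow> 'a)"
proof
  fix S T :: "'a bop" and x y :: 'a and r :: real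
  show "(S + T) x = S x + T x" by transfer (rule blinfun.add_left)
  show "(r *\<^sub>R T) x = r *\<^sub>R T x" by transfer (rule blinfun.scaleR_left)
  show "\<exists>K. \<forall>T (x::'a). norm (bop_apply T x) \<le> norm T * norm x * K"
    using norm_bop_apply by (intro exI[of _ 1]) auto
qed (simp_all add: bop_add bop_scaleR)

interpretation bop: bounded_bilinear bop_apply
  by (rule bounded_bilinear_bop_apply)

lemma bop_norm_le:
  assumes "0 \<le> b" "\<And>x. norm (bop_apply T x) \<le> b * norm x"
  shows "norm T \<le> b"
  using assms by transfer (rule norm_blinfun_bound)

lemma scaleC_bop_apply: "bop_apply (a *\<^sub>C T) x = a *\<^sub>C bop_apply T x"
  by transfer (simp add: Blinfun_scaleC_apply)

lemma cinner_eq_zero_iff [simp]: "cinner x x = 0 \<longleftrightarrow> x = (0 :: 'a::complex_inner)"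
  by (simp add: cinner_self)

lemma Re_cinner_self: "Re (cinner x x) = (norm (x :: 'a::complex_inner))\<^sup>2"
  by (simp add: cinner_self flip: of_real_power)

lemma cinner_right_eqI:
  assumes "\<And>x. cinner x y = cinner x (z :: 'a::complex_inner)"
  shows "y = z"
proof -
  have "cinner (y - z) (y - z) = 0"
    by (simp add: cinner.diff_right assms)
  then show ?thesis by simp
qed

lemma power2_norm_add:
  "(norm (x + y))\<^sup>2 = (norm x)\<^sup>2 + 2 * Re (cinner x y) + (norm (y :: 'a::complex_inner))\<^sup>2"
proof -
  have "Re (cinner y x) = Re (cinner x y)"
    by (subst cinner_commute) simp
  then show ?thesis
    by (simp add: cinner.add_left cinner.add_right flip: Re_cinner_self)
qed

section \<open>Riesz representation and the existence of adjoints\<close>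

lemma parallelogram_law:
  "(norm (x + y))\<^sup>2 + (norm (x - y))\<^sup>2 = 2 * (norm x)\<^sup>2 + 2 * (norm (y :: 'a::complex_inner))\<^sup>2"
  using power2_norm_add[of x y] power2_norm_add[of x "- y"] by (simp add: cinner.minus_right)

text \<open>The representing vector minimises the strictly convex functional
  \<open>norm x ^ 2 / 2 - f x\<close>; the parallelogram law makes every minimising sequence Cauchy.\<close>

lemma Riesz_real:
  fixes f :: "'a::complex_hilbert \<Rightarrow> real"
  assumes f: "bounded_linear f"
  shows "\<exists>u. \<forall>x. f x = Re (cinner x u)"
proof -
  interpret f: bounded_linear f by (rule f)
  define J where "J x = (norm x)\<^sup>2 / 2 - f x" for x
  obtain K where K: "\<And>x. \<bar>f x\<bar> \<le> norm x * K"
    using f.bounded by (auto simp: real_norm_def)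
  have J_ge: "- K\<^sup>2 / 2 \<le> J x" for x
  proof -
    have "0 \<le> (norm x - K)\<^sup>2" by simp
    then show ?thesis
      using K[of x] unfolding J_def power2_eq_square by (simp add: algebra_simps)
  qed
  define d where "d = (INF x. J x)"
  have bdd: "bdd_below (range J)"
    using J_ge by (rule bdd_belowI2)
  have d_le: "d \<le> J x" for x
    unfolding d_def by (rule cINF_lower[OF bdd]) simp
  have "\<exists>x. J x < d + 1 / Suc n" for n
    using cINF_less_iff[OF UNIV_not_empty bdd, of "d + 1 / Suc n"] unfolding d_def by auto
  then obtain X where X: "\<And>n. J (X n) < d + 1 / real (Suc n)" by metis
  \<comment> \<open>The midpoint of \<open>x\<close> and \<open>y\<close> also has
    \<open>J\<close>-value at least \<open>d\<close>, so by the parallelogram law two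
    near-minimisers must be close to each other.\<close>
  have mid: "(norm (x - y))\<^sup>2 \<le> 4 * (J x - d) + 4 * (J y - d)" for x y
  proof -
    have "J ((1/2) *\<^sub>R (x + y)) = (norm (x + y))\<^sup>2 / 8 - (f x + f y) / 2"
      by (simp add: J_def f.scaleR f.add power_divide)
    then have "d \<le> (norm (x + y))\<^sup>2 / 8 - (f x + f y) / 2"
      using d_le[of "(1/2) *\<^sub>R (x + y)"] by simp
    then show ?thesis
      using parallelogram_law[of x y] unfolding J_def by argo
  qed
  have "Cauchy X"
  proof (rule metric_CauchyI)
    fix e :: real assume "e > 0"
    obtain M where M: "1 / real (Suc M) < e\<^sup>2 / 8"
      using \<open>e > 0\<close> nat_approx_posE[of "e\<^sup>2 / 8"] by auto
    have small: "J (X n) - d < e\<^sup>2 / 8" if "n \<ge> M" for n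
    proof -
      have "1 / real (Suc n) \<le> 1 / real (Suc M)"
        using that by (simp add: frac_le)
      then show ?thesis using X[of n] M by linarith
    qed
    have "dist (X m) (X n) < e" if "m \<ge> M" "n \<ge> M" for m n
    proof -
      have "(norm (X m - X n))\<^sup>2 < e\<^sup>2"
        using mid[of "X m" "X n"] small[OF that(1)] small[OF that(2)] by argo
      then show ?thesis
        using \<open>e > 0\<close> by (simp add: dist_norm power2_less_imp_less)
    qed
    then show "\<exists>M. \<forall>m\<ge>M. \<forall>n\<ge>M. dist (X m) (X n) < e" by blast
  qed
  then obtain u where u: "X \<longlonglongrightarrow> u"
    by (auto simp: Cauchy_convergent_iff convergent_def)
  have "J u \<le> d"
  proof (rule LIMSEQ_le)
    show "(\<lambda>n. J (X n)) \<longlonglongrightarrow> J u"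
      unfolding J_def by (intro tendsto_intros u f.tendsto) simp
    show "(\<lambda>n. d + 1 / real (Suc n)) \<longlonglongrightarrow> d"
      using LIMSEQ_inverse_real_of_nat_add[of d] by (simp add: inverse_eq_divide)
    show "\<exists>N. \<forall>n\<ge>N. J (X n) \<le> d + 1 / real (Suc n)"
      using X less_imp_le by blast
  qed
  then have min: "J u \<le> J x" for x
    using d_le order.trans by blast
  have "f v = Re (cinner v u)" for v
  proof -
    \<comment> \<open>\<open>b\<close> is the derivative of \<open>J (u + t *\<^sub>R v)\<close> at
      \<open>t = 0\<close>, which has to vanish at a minimiser.\<close>
    define b where "b = Re (cinner v u) - f v"
    have *: "0 \<le> t * b + t\<^sup>2 * ((norm v)\<^sup>2 / 2)" for t
    proof -
      have "J (u + t *\<^sub>R v) = J u + t * b + t\<^sup>2 * ((norm v)\<^sup>2 / 2)"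
        using cinner_commute[of u v]
        by (simp add: J_def power2_norm_add f.add f.scaleR cinner.scaleR_right b_def
            power_mult_distrib field_simps)
      then show ?thesis using min[of "u + t *\<^sub>R v"] by linarith
    qed
    \<comment> \<open>Adding 1 keeps \<open>q\<close> positive also for \<open>v = 0\<close>; with
      \<open>t = - (b / q)\<close> the lower bound collapses to \<open>- (b / q)\<^sup>2\<close>,
      which forces \<open>b = 0\<close>.\<close>
    define q where "q = (norm v)\<^sup>2 / 2 + 1"
    have "q > 0" by (simp add: q_def add_nonneg_pos)
    have "0 \<le> (- (b / q)) * b + (- (b / q))\<^sup>2 * (q - 1)"
      using *[of "- (b / q)"] by (simp add: q_def)
    also have "\<dots> = - (b / q)\<^sup>2"
      using \<open>q > 0\<close> by (simp add: power2_eq_square field_simps)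
    finally show ?thesis
      using \<open>q > 0\<close> by (simp add: b_def)
  qed
  then show ?thesis by blast
qed

text \<open>The real part determines a complex-linear functional, since the imaginary part at
  \<open>x\<close> is minus the real part at \<open>\<i> *\<^sub>C x\<close>.\<close>

lemma Riesz:
  fixes f :: "'a::complex_hilbert \<Rightarrow> complex"
  assumes f: "bounded_linear f" and fC: "\<And>a x. f (a *\<^sub>C x) = a * f x"
  shows "\<exists>u. \<forall>x. f x = cinner x u"
proof -
  obtain u where u: "\<And>x. Re (f x) = Re (cinner x u)"
    using Riesz_real[OF bounded_linear_compose[OF bounded_linear_Re f]] by blast
  have "Im (f x) = Im (cinner x u)" for x
    using u[of "\<i> *\<^sub>C x"] by (simp add: fC cinner_scaleC_left)
  with u show ?thesis by (intro exI[of _ u]) (simp add: complex_eq_iff)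
qed

text \<open>\<open>adj\<close> is a choice, so a witness is needed. Riesz gives \<open>U y\<close>
  for each \<open>y\<close> separately; linearity follows because a representing vector is unique,
  and boundedness from testing with \<open>x = U y\<close> and cancelling one factor.\<close>

lemma adj_exists:
  fixes T :: "'a::complex_hilbert bop"
  shows "\<exists>U :: 'a bop. \<forall>x y. cinner (T x) y = cinner x (U y)"
proof -
  have "\<exists>u. \<forall>x. cinner (T x) y = cinner x u" for y
    by (rule Riesz)
      (auto intro!: bounded_linear_compose[OF cinner.bounded_linear_left] bop.bounded_linear_right
        simp: bop_scaleC cinner_scaleC_left)
  then obtain U where U: "\<And>x y. cinner (T x) y = cinner x (U y)" by metis
  have "norm (U y) \<le> norm y * norm T" for y
  proof -
    have "(norm (U y))\<^sup>2 = Re (cinner (T (U y)) y)"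
      by (simp add: U Re_cinner_self)
    also have "\<dots> \<le> norm (T (U y)) * norm y" by (rule Re_cinner_le)
    also have "\<dots> \<le> norm T * norm (U y) * norm y"
      by (intro mult_right_mono norm_bop_apply norm_ge_zero)
    finally have "norm (U y) * norm (U y) \<le> norm (U y) * (norm y * norm T)"
      by (simp add: power2_eq_square mult_ac)
    then show ?thesis
      by (cases "U y = 0") (auto simp: mult_le_cancel_left)
  qed
  moreover have "U (x + y) = U x + U y" for x y
    by (rule cinner_right_eqI) (simp add: cinner.add_right flip: U)
  moreover have "U (a *\<^sub>C x) = a *\<^sub>C U x" for a x
    by (rule cinner_right_eqI) (simp add: cinner_scaleC_right flip: U)
  ultimately obtain V where "bop_apply V = U"
    using bop_exI[of U "norm T"] by blast
  with U show ?thesis by metis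
qed

lemma cinner_adj_right: "cinner x (adj T y) = cinner (bop_apply T x) y"
  unfolding adj_def by (rule someI2_ex[OF adj_exists]) simp

lemma cinner_adj_left: "cinner (adj T x) y = cinner x (bop_apply T y)"
  by (metis cinner_adj_right cinner_commute)

lemma norm_adj_apply_le: "norm (adj T x) \<le> norm T * norm x"
proof -
  have "(norm (adj T x))\<^sup>2 = Re (cinner x (T (adj T x)))"
    using cinner_adj_left[of T x "adj T x"] by (simp flip: Re_cinner_self)
  also have "\<dots> \<le> norm x * (norm T * norm (adj T x))"
    using Re_cinner_le order.trans mult_left_mono[OF norm_bop_apply norm_ge_zero] by blast
  finally have "norm (adj T x) * norm (adj T x) \<le> norm (adj T x) * (norm T * norm x)"
    by (simp add: power2_eq_square mult_ac)
  then show ?thesis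
    by (cases "adj T x = 0") (auto simp: mult_le_cancel_left)
qed

section \<open>Completeness of the operator algebra, so that absolutely convergent operator series
  converge\<close>

instance bop :: (complex_hilbert) complete_space
proof
  fix X :: "nat \<Rightarrow> 'a bop"
  assume X: "Cauchy X"
  have lin: "norm (X m x - X n x) \<le> norm (X m - X n) * norm x" for m n x
    using norm_bop_apply[of "X m - X n" x] by (simp add: bop.diff_left)
  have Cauchy_app: "Cauchy (\<lambda>n. X n x)" for x
    using bounded_linear.Cauchy[OF bop.bounded_linear_left X] .
  then have "\<forall>x. \<exists>l. (\<lambda>n. X n x) \<longlonglongrightarrow> l"
    by (simp add: Cauchy_convergent_iff convergent_def)
  then obtain L where L: "\<And>x. (\<lambda>n. X n x) \<longlonglongrightarrow> L x" by metis
  obtain B where B: "\<And>n. norm (X n) \<le> B"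
    using Cauchy_Bseq[OF X] by (auto simp: Bseq_def)
  have "norm (L x) \<le> norm x * B" for x
  proof (rule LIMSEQ_le_const2[OF tendsto_norm[OF L]])
    show "\<exists>N. \<forall>n\<ge>N. norm (X n x) \<le> norm x * B"
      using order.trans[OF norm_bop_apply mult_right_mono[OF B norm_ge_zero]]
      by (metis mult.commute)
  qed
  moreover have "L (x + y) = L x + L y" for x y
    using LIMSEQ_unique[OF L[of "x + y"]] tendsto_add[OF L[of x] L[of y]] by (simp add: bop_add)
  moreover have "L (a *\<^sub>C x) = a *\<^sub>C L x" for a x
    using LIMSEQ_unique[OF L[of "a *\<^sub>C x"]]
      bounded_linear.tendsto[OF bounded_linear_scaleC L[of x]] by (simp add: bop_scaleC)
  ultimately obtain T where T: "bop_apply T = L"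
    using bop_exI[of L B] by blast
  have "X \<longlonglongrightarrow> T"
  proof (rule metric_LIMSEQ_I)
    fix e :: real assume "e > 0"
    then obtain M where M: "\<And>m n. m \<ge> M \<Longrightarrow> n \<ge> M \<Longrightarrow> norm (X m - X n) < e / 2"
      using CauchyD[OF X, of "e / 2"] by auto
    \<comment> \<open>Letting \<open>n\<close> tend to infinity in a bound that is uniform in
      \<open>x\<close> turns pointwise convergence into convergence in operator norm.\<close>
    have "norm (X m - T) \<le> e / 2" if m: "m \<ge> M" for m
    proof (rule bop_norm_le)
      fix x
      show "norm ((X m - T) x) \<le> e / 2 * norm x"
      proof (rule LIMSEQ_le_const2)
        show "(\<lambda>n. norm (X m x - X n x)) \<longlonglongrightarrow> norm ((X m - T) x)"
          unfolding bop.diff_left T by (intro tendsto_intros L)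
        show "\<exists>N. \<forall>n\<ge>N. norm (X m x - X n x) \<le> e / 2 * norm x"
          using M[OF m] lin[where m = m and x = x] by (meson less_imp_le mult_right_mono norm_ge_zero order.trans)
      qed
    qed (use \<open>e > 0\<close> in simp)
    then show "\<exists>M. \<forall>m\<ge>M. dist (X m) T < e"
      using \<open>e > 0\<close> by (metis dist_norm field_sum_of_halves less_add_same_cancel1 half_gt_zero order_le_less_trans)
  qed
  then show "convergent X" by (auto simp: convergent_def)
qed

instance bop :: (complex_hilbert) banach ..

section \<open>Square roots of positive operators\<close>

text \<open>The coefficient of \<open>t ^ k\<close> in the power series of the square root of
  \<open>1 - t\<close>.\<close>

definition sqrt_coeff :: "nat \<Rightarrow> real" where
  "sqrt_coeff k = (- 1) ^ k * ((1/2) gchoose k)"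

lemma sqrt_coeff_0 [simp]: "sqrt_coeff 0 = 1"
  by (simp add: sqrt_coeff_def)

lemma sqrt_coeff_Suc: "sqrt_coeff (Suc k) = sqrt_coeff k * ((real k - 1/2) / real (Suc k))"
proof -
  have "((1/2) gchoose Suc k) = ((1/2) gchoose k) * (1/2 - real k) / real (Suc k)"
    using gbinomial_mult_1[of "1/2 :: real" k]
    by (simp add: eq_divide_eq algebra_simps)
  then have "sqrt_coeff (Suc k) = - ((- 1) ^ k * (((1/2) gchoose k) * (1/2 - real k) / real (Suc k)))"
    by (simp add: sqrt_coeff_def)
  also have "\<dots> = sqrt_coeff k * ((real k - 1/2) / real (Suc k))"
    unfolding sqrt_coeff_def by (simp add: divide_simps del: of_nat_Suc) (simp add: algebra_simps)
  finally show ?thesis .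
qed

text \<open>In the recursion the factor \<open>real k - 1/2\<close> is negative only at
  \<open>k = 0\<close>, so the sign changes once and never again.\<close>

lemma sqrt_coeff_Suc_nonpos: "sqrt_coeff (Suc k) \<le> 0"
proof (induction k)
  case 0
  show ?case by (simp add: sqrt_coeff_Suc)
next
  case (Suc k)
  then show ?case
    by (subst sqrt_coeff_Suc) (intro mult_nonpos_nonneg, auto)
qed

text \<open>Alternating partial sums of a binomial series telescope to a single coefficient, here
  that of exponent -1/2, whose sign is \<open>(- 1) ^ n\<close>.\<close>

lemma sum_sqrt_coeff_nonneg: "0 \<le> (\<Sum>k\<le>n. sqrt_coeff k)"
proof -
  have "(\<Sum>k\<le>n. sqrt_coeff k) = (- 1) ^ n * ((1/2 - 1) gchoose n)"
    unfolding gbinomial_sum_lower_neg[symmetric] by (simp add: sqrt_coeff_def mult.commute)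
  also have "\<dots> = pochhammer (1/2) n / fact n"
    by (simp add: gbinomial_pochhammer flip: mult.assoc power_mult_distrib)
  also have "\<dots> \<ge> 0"
    by (intro divide_nonneg_nonneg pochhammer_nonneg) auto
  finally show ?thesis .
qed

text \<open>All these coefficients have one sign, so their absolute values add up to 1 minus a
  nonnegative partial sum. The bound 1 is what makes the operator root positive.\<close>

lemma abs_sqrt_coeff_Suc:
  shows summable_abs_sqrt_coeff_Suc: "summable (\<lambda>k. \<bar>sqrt_coeff (Suc k)\<bar>)"
    and suminf_abs_sqrt_coeff_Suc: "(\<Sum>k. \<bar>sqrt_coeff (Suc k)\<bar>) \<le> 1"
proof -
  have le: "(\<Sum>k<n. \<bar>sqrt_coeff (Suc k)\<bar>) \<le> 1" for n
  proof -
    have "(\<Sum>k<n. \<bar>sqrt_coeff (Suc k)\<bar>) = - (\<Sum>k<n. sqrt_coeff (Suc k))"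
      unfolding sum_negf[symmetric] using sqrt_coeff_Suc_nonpos by (intro sum.cong) auto
    also have "\<dots> = 1 - (\<Sum>k\<le>n. sqrt_coeff k)"
      by (simp add: sum.atMost_shift)
    also have "\<dots> \<le> 1"
      using sum_sqrt_coeff_nonneg[of n] by simp
    finally show ?thesis .
  qed
  then show "summable (\<lambda>k. \<bar>sqrt_coeff (Suc k)\<bar>)"
    by (intro summableI_nonneg_bounded[where x = 1]) auto
  then show "(\<Sum>k. \<bar>sqrt_coeff (Suc k)\<bar>) \<le> 1"
    using le by (intro suminf_le_const) auto
qed

text \<open>Vandermonde with 1/2 + 1/2 = 1: squaring the series leaves only the coefficients of
  \<open>1 - t\<close>.\<close>

lemma sqrt_coeff_convolution:
  "(\<Sum>i\<le>n. sqrt_coeff i * sqrt_coeff (n - i)) = (if n = 0 then 1 else if n = 1 then - 1 else 0)"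
proof -
  have "(\<Sum>i\<le>n. sqrt_coeff i * sqrt_coeff (n - i))
      = (\<Sum>i\<le>n. (- 1) ^ n * (((1/2) gchoose i) * ((1/2) gchoose (n - i))))"
    by (intro sum.cong) (auto simp: sqrt_coeff_def simp flip: power_add)
  also have "\<dots> = (- 1) ^ n * ((1/2 + 1/2) gchoose n)"
    unfolding gbinomial_Vandermonde[symmetric] by (simp add: sum_distrib_left atLeast0AtMost)
  also have "((1/2 + 1/2 :: real) gchoose n) = real (1 choose n)"
    by (simp add: binomial_gbinomial)
  finally show ?thesis
    by (cases n) (auto simp: binomial_eq_0)
qed

lemma norm_power_bop_le_one:
  assumes "norm (A :: 'a::complex_inner bop) \<le> 1"
  shows "norm (A ^ k) \<le> 1"
proof (induction k)
  case 0
  \<comment> \<open>Only an inequality can be claimed, as the identity has norm 0 on the zero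
    space.\<close>
  show ?case by (intro bop_norm_le) (auto simp: one_bop_apply)
next
  case (Suc k)
  then show ?case
    using norm_mult_ineq[of A "A ^ k"] mult_mono[OF assms Suc] by simp
qed

text \<open>The root is the binomial series of \<open>sqrt (1 - A)\<close>, absolutely convergent for
  \<open>norm A \<le> 1\<close>; it is positive because \<open>1\<close> dominates the sum of the other terms.\<close>

lemma positive_sqrt_one_minus:
  fixes A :: "'a::complex_hilbert bop"
  assumes norm_A: "norm A \<le> 1" and sym: "\<And>x y. cinner (A x) y = cinner x (A y)"
  shows "\<exists>R. positive_op R \<and> R\<^sup>2 = 1 - A"
proof -
  define a where "a k = sqrt_coeff k *\<^sub>R A ^ k" for k
  have norm_a: "norm (a k) \<le> \<bar>sqrt_coeff k\<bar>" for k
    using mult_left_mono[OF norm_power_bop_le_one[OF norm_A, of k], of "\<bar>sqrt_coeff k\<bar>"]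
    by (simp add: a_def)
  have "summable (\<lambda>k. \<bar>sqrt_coeff k\<bar>)"
    using summable_abs_sqrt_coeff_Suc summable_Suc_iff[of "\<lambda>k. \<bar>sqrt_coeff k\<bar>"] by simp
  then have abs_summ: "summable (\<lambda>k. norm (a k))"
    by (rule summable_comparison_test'[where N = 0]) (simp add: norm_a)
  then have summ: "summable a" by (rule summable_norm_cancel)
  define R where "R = suminf a"
  have conv: "(\<Sum>i\<le>k. a i * a (k - i)) = (if k = 0 then 1 else if k = 1 then - A else 0)" for k
  proof -
    have "(\<Sum>i\<le>k. a i * a (k - i)) = (\<Sum>i\<le>k. (sqrt_coeff i * sqrt_coeff (k - i)) *\<^sub>R A ^ k)"
      by (intro sum.cong) (auto simp: a_def simp flip: power_add)
    also have "\<dots> = (\<Sum>i\<le>k. sqrt_coeff i * sqrt_coeff (k - i)) *\<^sub>R A ^ k"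
      by (simp add: scaleR_sum_left)
    finally show ?thesis
      by (simp add: sqrt_coeff_convolution)
  qed
  have "(\<lambda>k. if k = 0 then 1 else if k = 1 then - A else 0) sums R\<^sup>2"
    using Cauchy_product_sums[OF abs_summ abs_summ] unfolding conv R_def power2_eq_square .
  moreover have "(\<lambda>k. if k = 0 then 1 else if k = 1 then - A else 0) sums (1 - A)"
    using sums_finite[of "{0, 1}" "\<lambda>k. if k = (0::nat) then 1 else if k = 1 then - A else 0"] by simp
  ultimately have sq: "R\<^sup>2 = 1 - A"
    by (rule sums_unique2)
  have sym_pow: "cinner ((A ^ k) x) y = cinner x ((A ^ k) y)" for k x y
  proof (induction k arbitrary: x y)
    case (Suc k)
    then show ?case by (metis power_Suc power_Suc2 sym times_bop_apply)
  qed (simp add: one_bop_apply)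
  have "cinner (R x) x \<in> \<real>\<^sub>\<ge>\<^sub>0" for x
  proof -
    define c where "c k = cinner (a k x) x" for k
    have bl: "bounded_linear (\<lambda>T. cinner (bop_apply T x) x)"
      by (intro bounded_linear_compose[OF cinner.bounded_linear_left] bop.bounded_linear_left)
    have c_sums: "c sums cinner (R x) x"
      unfolding c_def R_def by (rule bounded_linear.sums[OF bl summable_sums[OF summ]])
    \<comment> \<open>Powers of a symmetric operator are symmetric, so every term of the series is
      real and positivity concerns the real part alone.\<close>
    have "cinner ((A ^ k) x) x \<in> \<real>" for k
      by (metis cinner_commute sym_pow Reals_cnj_iff)
    then have "c k \<in> \<real>" for k
      by (simp add: c_def a_def bop.scaleR_left cinner.scaleR_left scaleR_conv_of_real)
    then have Im0: "Im (c k) = 0" for k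
      by (simp add: complex_is_Real_iff)
    have "Im (cinner (R x) x) = 0"
      using sums_Im[OF c_sums] sums_unique[of "\<lambda>_. 0 :: real"] by (simp add: Im0)
    moreover have "0 \<le> Re (cinner (R x) x)"
    proof -
      \<comment> \<open>The term \<open>k = 0\<close> contributes exactly
        \<open>(norm x)\<^sup>2\<close>; the tail can take away at most that much.\<close>
      have Re_sums: "(\<lambda>k. Re (c (Suc k))) sums (Re (cinner (R x) x) - (norm x)\<^sup>2)"
        using sums_Re[OF c_sums]
        by (simp add: sums_Suc_iff[of "\<lambda>k. Re (c k)"]) (simp add: c_def a_def one_bop_apply Re_cinner_self)
      have bound: "- (\<bar>sqrt_coeff k\<bar> * (norm x)\<^sup>2) \<le> Re (c k)" for k
      proof -
        have "cmod (c k) \<le> norm (a k) * norm x * norm x"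
          unfolding c_def
          by (rule order.trans[OF norm_cinner_le]) (intro mult_right_mono norm_bop_apply norm_ge_zero)
        also have "\<dots> \<le> \<bar>sqrt_coeff k\<bar> * (norm x)\<^sup>2"
          using mult_right_mono[OF norm_a, of "(norm x)\<^sup>2" k] by (simp add: power2_eq_square mult_ac)
        finally show ?thesis
          using abs_Re_le_cmod[of "c k"] by linarith
      qed
      have "- (norm x)\<^sup>2 \<le> - ((\<Sum>k. \<bar>sqrt_coeff (Suc k)\<bar>) * (norm x)\<^sup>2)"
        using mult_right_mono[OF suminf_abs_sqrt_coeff_Suc, of "(norm x)\<^sup>2"] by simp
      also have "\<dots> \<le> Re (cinner (R x) x) - (norm x)\<^sup>2"
        by (rule sums_le[OF bound sums_minus[OF sums_mult2[OF summable_sums]] Re_sums])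
          (rule summable_abs_sqrt_coeff_Suc)
      finally show ?thesis by simp
    qed
    ultimately show ?thesis
      by (simp add: complex_nonneg_Reals_iff)
  qed
  with sq show ?thesis
    unfolding positive_op_def by blast
qed

text \<open>After division by \<open>(norm B)\<^sup>2\<close> the operator \<open>adj B * B\<close>
  has the form \<open>1 - A\<close> with \<open>A\<close> a symmetric contraction; the root is then
  scaled back by \<open>norm B\<close>.\<close>

lemma positive_sqrt_adj_mult:
  fixes B :: "'a::complex_hilbert bop"
  shows "\<exists>R. positive_op R \<and> R\<^sup>2 = adj B * B"
proof (cases "B = 0")
  case True
  then have "adj B * B = 0" by simp
  then show ?thesis
    by (intro exI[of _ 0]) (simp add: positive_op_def bop.zero_left cinner.zero_left power2_eq_square)
next
  case False
  define b where "b = norm B"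
  have "b > 0" using False by (simp add: b_def)
  define A where "A = 1 - inverse (b\<^sup>2) *\<^sub>R (adj B * B)"
  have A: "A x = x - inverse (b\<^sup>2) *\<^sub>R adj B (B x)" for x
    by (simp add: A_def bop.diff_left bop.scaleR_left one_bop_apply times_bop_apply)
  have "norm (A x) \<le> norm x" for x
  proof -
    \<comment> \<open>The last term is at most half the size of the negative middle one, so the norm
      does not grow.\<close>
    have "(norm (A x))\<^sup>2 = (norm x)\<^sup>2 - 2 * (norm (B x))\<^sup>2 / b\<^sup>2 + (norm (adj B (B x)))\<^sup>2 / b ^ 4"
      using power2_norm_add[of x "- (inverse (b\<^sup>2) *\<^sub>R adj B (B x))"]
      by (simp add: A cinner.minus_right cinner.scaleR_right cinner_adj_right Re_cinner_self
          power_mult_distrib power_inverse divide_inverse)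
    moreover have "(norm (adj B (B x)))\<^sup>2 / b ^ 4 \<le> b\<^sup>2 * (norm (B x))\<^sup>2 / b ^ 4"
      using power_mono[OF norm_adj_apply_le[of B "B x"] norm_ge_zero, of 2]
      by (intro divide_right_mono) (auto simp: b_def power_mult_distrib)
    moreover have "b\<^sup>2 * (norm (B x))\<^sup>2 / b ^ 4 = (norm (B x))\<^sup>2 / b\<^sup>2"
      using \<open>b > 0\<close> by (simp add: power2_eq_square power4_eq_xxxx)
    moreover have "0 \<le> (norm (B x))\<^sup>2 / b\<^sup>2"
      by simp
    ultimately have "(norm (A x))\<^sup>2 \<le> (norm x)\<^sup>2"
      unfolding times_divide_eq_right[symmetric] by linarith
    then show ?thesis
      by (rule power2_le_imp_le) simp
  qed
  then have "norm A \<le> 1"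
    by (intro bop_norm_le) auto
  moreover have "cinner (A x) y = cinner x (A y)" for x y
    by (simp add: A cinner.diff_left cinner.diff_right cinner.scaleR_left cinner.scaleR_right
        cinner_adj_left cinner_adj_right)
  ultimately obtain R where R: "positive_op R" "R\<^sup>2 = 1 - A"
    using positive_sqrt_one_minus by blast
  have "(b *\<^sub>R R)\<^sup>2 = b\<^sup>2 *\<^sub>R R\<^sup>2"
    by (simp add: power2_eq_square)
  also have "\<dots> = adj B * B"
    using \<open>b > 0\<close> by (simp add: R(2) A_def)
  finally have "(b *\<^sub>R R)\<^sup>2 = adj B * B" .
  moreover have "positive_op (b *\<^sub>R R)"
    using R(1) \<open>b > 0\<close>
    by (simp add: positive_op_def bop.scaleR_left cinner.scaleR_left complex_nonneg_Reals_iff)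
  ultimately show ?thesis by blast
qed

lemma abs_op_power2: "(abs_op B)\<^sup>2 = adj B * B"
  unfolding abs_op_def sqrt_op_def by (rule someI2_ex[OF positive_sqrt_adj_mult]) simp

section \<open>Isometric weighted shifts\<close>

text \<open>The weights in \<open>m_isometric\<close>, which are also the coefficients of the
  \<open>m\<close>-th forward difference.\<close>

definition m_coeff :: "nat \<Rightarrow> nat \<Rightarrow> real" where
  "m_coeff m k = real (m choose k) * (- 1) ^ (m - k)"

text \<open>Polarisation: expanding at \<open>x + y\<close> and then replacing \<open>y\<close> by
  \<open>\<i> *\<^sub>C y\<close> kills the form off the diagonal. Complex scalars are essential, as
  a real rotation by a right angle shows.\<close>

lemma bop_eq_zeroI:
  fixes D :: "'a::complex_inner bop"
  assumes "\<And>x. cinner (D x) x = 0"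
  shows "D = 0"
proof -
  have "D x = 0" for x
  proof -
    have *: "cinner (D x) y + cinner (D y) x = 0" for x y
      using assms[of "x + y"] by (simp add: bop_add cinner.add_left cinner.add_right assms add.commute)
    have "cinner (D x) (\<i> *\<^sub>C y) + cinner (D (\<i> *\<^sub>C y)) x = \<i> * (cinner (D y) x - cinner (D x) y)" for y
      by (simp add: bop_scaleC cinner_scaleC_left cinner_scaleC_right algebra_simps)
    then have "cinner (D y) x = cinner (D x) y" for y
      using *[of x "\<i> *\<^sub>C y"] by simp
    then have "cinner (D x) (D x) = 0"
      using *[of x "D x"] by simp
    then show ?thesis by simp
  qed
  then show ?thesis
    by (intro bop_eqI) (simp add: bop.zero_left)
qed

lemma cinner_adj_power: "cinner ((adj T ^ k) x) y = cinner x ((T ^ k) y)"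
proof (induction k arbitrary: x y)
  case (Suc k)
  then show ?case
    by (metis cinner_adj_left power_Suc power_Suc2 times_bop_apply)
qed (simp add: one_bop_apply)

lemma m_isometric_iff:
  "m_isometric m T \<longleftrightarrow> (\<forall>h. (\<Sum>k\<le>m. m_coeff m k * (norm ((T ^ k) h))\<^sup>2) = 0)"
proof -
  define D where "D = (\<Sum>k\<le>m. m_coeff m k *\<^sub>R (adj T ^ k * T ^ k))"
  have D: "cinner (D h) h = complex_of_real (\<Sum>k\<le>m. m_coeff m k * (norm ((T ^ k) h))\<^sup>2)" for h
    by (simp add: D_def bop.sum_left cinner.sum_left bop.scaleR_left cinner.scaleR_left
        times_bop_apply cinner_adj_power cinner_self scaleR_conv_of_real)
  have "m_isometric m T \<longleftrightarrow> D = 0"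
    by (simp add: m_isometric_def D_def m_coeff_def)
  also have "\<dots> \<longleftrightarrow> (\<forall>h. cinner (D h) h = 0)"
    by (auto intro: bop_eq_zeroI simp: bop.zero_left cinner.zero_left)
  finally show ?thesis
    by (simp only: D of_real_eq_0_iff)
qed

section \<open>Square-summable sequences and powers of a shift\<close>

lemma power2_norm_ell2: "(norm f)\<^sup>2 = (\<Sum>i. (norm (ell2_nth f i))\<^sup>2)"
  by (simp add: norm_ell2.rep_eq suminf_nonneg ell2_summable)

lemma ell2_eqI: "(\<And>i. ell2_nth f i = ell2_nth g i) \<Longrightarrow> f = g"
  by (simp add: ell2_nth_inject[symmetric] fun_eq_iff)

lift_definition ell2_single :: "nat \<Rightarrow> 'a::complex_inner \<Rightarrow> 'a ell2"
  is "\<lambda>n x i. if i = n then x else 0"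
  by (rule summable_finite[of "{n}" for n]) auto

lemma norm_ell2_single: "norm (ell2_single n x) = norm x"
proof -
  have "(norm (ell2_single n x))\<^sup>2 = (norm x)\<^sup>2"
    unfolding power2_norm_ell2 ell2_single.rep_eq
    using suminf_finite[of "{n}" "\<lambda>i. (norm (if i = n then x else 0))\<^sup>2"] by simp
  then show ?thesis by simp
qed

lemma shift_ell2_single:
  assumes "is_weighted_shift W S"
  shows "S (ell2_single n x) = ell2_single (Suc n) (W (Suc n) x)"
proof (rule ell2_eqI)
  fix i
  show "ell2_nth (S (ell2_single n x)) i = ell2_nth (ell2_single (Suc n) (W (Suc n) x)) i"
    using assms by (cases i) (auto simp: is_weighted_shift_def ell2_single.rep_eq bop_zero)
qed

lemma shift_power_ell2_single:
  assumes "is_weighted_shift W S"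
  shows "(S ^ k) (ell2_single n (shift_prod W n x)) = ell2_single (n + k) (shift_prod W (n + k) x)"
  by (induction k) (simp_all add: one_bop_apply times_bop_apply shift_ell2_single[OF assms])

text \<open>Right inverses of the weights give preimages, so every entry of a sequence can be
  written as \<open>shift_prod W n x\<close>.\<close>

lemma shift_prod_surj:
  assumes "\<And>j. j \<ge> 1 \<Longrightarrow> invertible_op (W j)"
  shows "\<exists>x. shift_prod W n x = y"
proof (induction n arbitrary: y)
  case (Suc n)
  obtain U where "W (Suc n) * U = 1"
    using assms[of "Suc n"] by (auto simp: invertible_op_def)
  then have "W (Suc n) (U y) = y"
    by (metis times_bop_apply one_bop_apply)
  with Suc[of "U y"] show ?case by (metis shift_prod.simps(2) times_bop_apply)
qed (simp add: one_bop_apply)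

lemma shift_power_nth:
  assumes S: "is_weighted_shift W S" and x: "\<And>n. ell2_nth h n = shift_prod W n (x n)"
  shows "ell2_nth ((S ^ k) h) i = (if i < k then 0 else shift_prod W i (x (i - k)))"
proof (induction k arbitrary: i)
  case 0
  show ?case by (simp add: one_bop_apply x)
next
  case (Suc k)
  then show ?case
    using S by (cases i) (auto simp: times_bop_apply is_weighted_shift_def bop_zero)
qed

text \<open>Forwards, test the norm identity on sequences supported at one index; backwards, sum the
  scalar identities over all entries.\<close>

lemma m_isometric_shift_iff:
  fixes W :: "nat \<Rightarrow> 'h::complex_hilbert bop"
  assumes inv: "\<And>j. j \<ge> 1 \<Longrightarrow> invertible_op (W j)" and S: "is_weighted_shift W S"
  shows "m_isometric m S \<longleftrightarrow>
    (\<forall>x n. (\<Sum>k\<le>m. m_coeff m k * (norm (shift_prod W (n + k) x))\<^sup>2) = 0)"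
proof
  assume iso: "m_isometric m S"
  show "\<forall>x n. (\<Sum>k\<le>m. m_coeff m k * (norm (shift_prod W (n + k) x))\<^sup>2) = 0"
  proof (intro allI)
    fix x n
    have "(\<Sum>k\<le>m. m_coeff m k * (norm ((S ^ k) (ell2_single n (shift_prod W n x))))\<^sup>2) = 0"
      using iso by (simp add: m_isometric_iff)
    then show "(\<Sum>k\<le>m. m_coeff m k * (norm (shift_prod W (n + k) x))\<^sup>2) = 0"
      by (simp add: shift_power_ell2_single[OF S] norm_ell2_single)
  qed
next
  assume zero: "\<forall>x n. (\<Sum>k\<le>m. m_coeff m k * (norm (shift_prod W (n + k) x))\<^sup>2) = 0"
  show "m_isometric m S"
    unfolding m_isometric_iff
  proof
    fix h
    have "\<exists>x. shift_prod W n x = ell2_nth h n" for n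
      by (rule shift_prod_surj[OF inv])
    then obtain x where x: "\<And>n. ell2_nth h n = shift_prod W n (x n)" by metis
    have "(\<lambda>n. (norm (shift_prod W (n + k) (x n)))\<^sup>2) sums (norm ((S ^ k) h))\<^sup>2" for k
    proof -
      \<comment> \<open>The first \<open>k\<close> entries vanish; dropping them aligns the series
        for different \<open>k\<close> along the same \<open>x n\<close>, so they can be combined
        termwise.\<close>
      have "(norm ((S ^ k) h))\<^sup>2 = (\<Sum>n. (norm (ell2_nth ((S ^ k) h) (n + k)))\<^sup>2)"
        unfolding power2_norm_ell2
        using suminf_split_initial_segment[OF ell2_summable, of "(S ^ k) h" k]
        by (simp add: shift_power_nth[OF S x])
      moreover have "summable (\<lambda>n. (norm (ell2_nth ((S ^ k) h) (n + k)))\<^sup>2)"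
        by (rule summable_ignore_initial_segment[OF ell2_summable])
      ultimately show ?thesis
        by (simp add: sums_iff shift_power_nth[OF S x])
    qed
    then have "(\<lambda>n. \<Sum>k\<le>m. m_coeff m k * (norm (shift_prod W (n + k) (x n)))\<^sup>2)
        sums (\<Sum>k\<le>m. m_coeff m k * (norm ((S ^ k) h))\<^sup>2)"
      by (intro sums_sum sums_mult)
    then show "(\<Sum>k\<le>m. m_coeff m k * (norm ((S ^ k) h))\<^sup>2) = 0"
      using zero by (simp add: sums_iff)
  qed
qed

section \<open>The scalar shift attached to a vector\<close>

text \<open>The quotients defining the weights telescope.\<close>

lemma norm_shift_prod_vector_weight:
  assumes nz: "\<And>n. shift_prod W n x \<noteq> 0"
  shows "norm (shift_prod (\<lambda>j. vector_weight W x j *\<^sub>R (1 :: complex bop)) n z)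
    = norm (shift_prod W n x) / norm x * norm z"
proof (induction n)
  case 0
  show ?case using nz[of 0] by (simp add: one_bop_apply)
next
  case (Suc n)
  have "vector_weight W x (Suc n) \<ge> 0" by (simp add: vector_weight_def)
  with Suc nz[of n] show ?case
    by (simp add: times_bop_apply bop.scaleR_left one_bop_apply) (simp add: vector_weight_def times_bop_apply)
qed

lemma m_isometric_vector_weight_iff:
  fixes W :: "nat \<Rightarrow> 'h::complex_hilbert bop"
  assumes bdd: "bounded (W ` {1..})" and inv: "\<And>j. j \<ge> 1 \<Longrightarrow> invertible_op (W j)" and "x \<noteq> 0"
  shows "m_isometric m (scalar_weighted_shift (vector_weight W x)) \<longleftrightarrow>
    (\<forall>n. (\<Sum>k\<le>m. m_coeff m k * (norm (shift_prod W (n + k) x))\<^sup>2) = 0)"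
proof -
  define V where "V j = vector_weight W x j *\<^sub>R (1 :: complex bop)" for j
  have nz: "shift_prod W n x \<noteq> 0" for n
    using shift_prod_nonzero[OF inv \<open>x \<noteq> 0\<close>] .
  have pos: "vector_weight W x j > 0" for j
    by (rule vector_weight_pos) (use inv \<open>x \<noteq> 0\<close> in auto)
  have "invertible_op (V j)" for j
    unfolding invertible_op_def
    by (rule exI[of _ "inverse (vector_weight W x j) *\<^sub>R 1"])
      (use pos[of j] in \<open>simp add: V_def\<close>)
  moreover have "is_weighted_shift V (scalar_weighted_shift (vector_weight W x))"
    unfolding scalar_weighted_shift_def V_def
    by (rule is_weighted_shift_weighted_shift[OF bounded_vector_weight[OF bdd]])
  ultimately have "m_isometric m (scalar_weighted_shift (vector_weight W x)) \<longleftrightarrow>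
      (\<forall>z n. (\<Sum>k\<le>m. m_coeff m k * (norm (shift_prod V (n + k) z))\<^sup>2) = 0)"
    by (intro m_isometric_shift_iff)
  \<comment> \<open>Passing to the scalar shift only multiplies each difference by a factor
    independent of \<open>n\<close>, and this factor is nonzero at \<open>z = 1\<close>.\<close>
  also have "\<dots> \<longleftrightarrow> (\<forall>z :: complex. \<forall>n. (norm z / norm x)\<^sup>2
      * (\<Sum>k\<le>m. m_coeff m k * (norm (shift_prod W (n + k) x))\<^sup>2) = 0)"
    unfolding V_def norm_shift_prod_vector_weight[OF nz]
    by (simp add: sum_distrib_left power_mult_distrib power_divide mult_ac)
  also have "\<dots> \<longleftrightarrow> (\<forall>n. (\<Sum>k\<le>m. m_coeff m k * (norm (shift_prod W (n + k) x))\<^sup>2) = 0)"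
    using \<open>x \<noteq> 0\<close> by (auto dest: spec[of _ "1 :: complex"])
  finally show ?thesis .
qed

section \<open>Finite differences and operator polynomials\<close>

definition fdiff :: "(nat \<Rightarrow> 'a::ab_group_add) \<Rightarrow> nat \<Rightarrow> 'a" where
  "fdiff f n = f (Suc n) - f n"

lemma fdiff_power_Suc: "(fdiff ^^ Suc m) f = (fdiff ^^ m) (fdiff f)"
  by (simp add: funpow_swap1)

lemma fdiff_power_sum:
  fixes f :: "nat \<Rightarrow> 'a::real_vector"
  shows "(fdiff ^^ m) f n = (\<Sum>k\<le>m. m_coeff m k *\<^sub>R f (n + k))"
proof (induction m arbitrary: n)
  case 0
  show ?case by (simp add: m_coeff_def)
next
  case (Suc m)
  \<comment> \<open>Pascal's rule with signs. The case \<open>k = m\<close> is separate because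
    \<open>m - Suc k\<close> truncates there, while the binomial coefficient vanishes.\<close>
  have rec: "m_coeff (Suc m) (Suc k) = m_coeff m k - m_coeff m (Suc k)" if "k \<le> m" for k
  proof (cases "k = m")
    case False
    with that have "m - k = Suc (m - Suc k)" by simp
    then show ?thesis by (simp add: m_coeff_def algebra_simps)
  qed (simp add: m_coeff_def)
  have "(\<Sum>k\<le>m. m_coeff m k *\<^sub>R f (n + k))
      = m_coeff m 0 *\<^sub>R f n + (\<Sum>k\<le>m. m_coeff m (Suc k) *\<^sub>R f (Suc (n + k)))"
    using sum.atMost_shift[of "\<lambda>k. m_coeff m k *\<^sub>R f (n + k)" "Suc m"]
    by (simp add: lessThan_Suc_atMost) (simp add: m_coeff_def binomial_eq_0)
  then have "(fdiff ^^ Suc m) f n = (\<Sum>k\<le>m. m_coeff m k *\<^sub>R f (Suc (n + k)))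
      - m_coeff m 0 *\<^sub>R f n - (\<Sum>k\<le>m. m_coeff m (Suc k) *\<^sub>R f (Suc (n + k)))"
    by (simp add: fdiff_def Suc)
  also have "\<dots> = m_coeff (Suc m) 0 *\<^sub>R f n + (\<Sum>k\<le>m. m_coeff (Suc m) (Suc k) *\<^sub>R f (Suc (n + k)))"
    by (simp add: rec scaleR_diff_left sum_subtractf) (simp add: m_coeff_def)
  also have "\<dots> = (\<Sum>k\<le>Suc m. m_coeff (Suc m) k *\<^sub>R f (n + k))"
    using sum.atMost_shift[of "\<lambda>k. m_coeff (Suc m) k *\<^sub>R f (n + k)" "Suc m"]
    by (simp add: lessThan_Suc_atMost del: sum.atMost_Suc)
  finally show ?case .
qed

text \<open>A Leibniz rule for multiplication by \<open>n\<close>; it drives the induction on the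
  degree of a monomial.\<close>

lemma fdiff_power_of_nat_mult:
  fixes f :: "nat \<Rightarrow> 'a::comm_ring_1"
  shows "(fdiff ^^ Suc d) (\<lambda>n. of_nat n * f n) n
    = of_nat n * (fdiff ^^ Suc d) f n + of_nat (Suc d) * (fdiff ^^ d) f (Suc n)"
proof (induction d arbitrary: n)
  case 0
  show ?case by (simp add: fdiff_def algebra_simps)
next
  case (Suc d)
  have "(fdiff ^^ Suc (Suc d)) (\<lambda>n. of_nat n * f n) n
      = fdiff ((fdiff ^^ Suc d) (\<lambda>n. of_nat n * f n)) n"
    by simp
  also have "\<dots> = of_nat (Suc n) * (fdiff ^^ Suc d) f (Suc n) + of_nat (Suc d) * (fdiff ^^ d) f (Suc (Suc n))
      - (of_nat n * (fdiff ^^ Suc d) f n + of_nat (Suc d) * (fdiff ^^ d) f (Suc n))"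
    unfolding fdiff_def[of "(fdiff ^^ Suc d) (\<lambda>n. of_nat n * f n)"] Suc ..
  also have "\<dots> = of_nat n * (fdiff ^^ Suc (Suc d)) f n + of_nat (Suc (Suc d)) * (fdiff ^^ Suc d) f (Suc n)"
    by (simp add: fdiff_def algebra_simps)
  finally show ?case .
qed

lemma fdiff_power_zero: "(fdiff ^^ m) (\<lambda>n. 0) n = 0"
  by (induction m arbitrary: n) (simp_all add: fdiff_def)

lemma fdiff_power_monomial:
  "j < m \<Longrightarrow> (fdiff ^^ m) (\<lambda>n. of_nat n ^ j :: 'a::comm_ring_1) n = 0"
proof (induction j arbitrary: m n)
  case 0
  have "fdiff (\<lambda>n. 1 :: 'a) = (\<lambda>n. 0)"
    by (simp add: fdiff_def fun_eq_iff)
  with 0 show ?case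
    by (cases m) (simp_all add: fdiff_power_Suc fdiff_power_zero del: funpow.simps)
next
  case (Suc j)
  then obtain d where m: "m = Suc d" by (cases m) auto
  with Suc.prems have "j < d" "j < Suc d" by auto
  then show ?case
    by (simp add: m fdiff_power_of_nat_mult Suc.IH del: funpow.simps)
qed

text \<open>Induction on \<open>n\<close> for all \<open>f\<close> at once: the step uses the
  hypothesis for both \<open>f\<close> and \<open>fdiff f\<close>, merged by Pascal's rule.\<close>

lemma newton_forward:
  fixes f :: "nat \<Rightarrow> 'a::real_vector"
  shows "f n = (\<Sum>j\<le>n. real (n choose j) *\<^sub>R (fdiff ^^ j) f 0)"
proof (induction n arbitrary: f)
  case 0
  show ?case by simp
next
  case (Suc n)
  have "f (Suc n) = f n + fdiff f n"
    by (simp add: fdiff_def)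
  also have "f n = f 0 + (\<Sum>j\<le>n. real (n choose Suc j) *\<^sub>R (fdiff ^^ Suc j) f 0)"
    using Suc[of f] sum.atMost_shift[of "\<lambda>j. real (n choose j) *\<^sub>R (fdiff ^^ j) f 0" "Suc n"]
    by (simp add: lessThan_Suc_atMost binomial_eq_0)
  also have "fdiff f n = (\<Sum>j\<le>n. real (n choose j) *\<^sub>R (fdiff ^^ Suc j) f 0)"
    using Suc[of "fdiff f"] by (simp add: fdiff_power_Suc del: funpow.simps)
  also have "f 0 + (\<Sum>j\<le>n. real (n choose Suc j) *\<^sub>R (fdiff ^^ Suc j) f 0)
        + (\<Sum>j\<le>n. real (n choose j) *\<^sub>R (fdiff ^^ Suc j) f 0)
      = f 0 + (\<Sum>j\<le>n. real (Suc n choose Suc j) *\<^sub>R (fdiff ^^ Suc j) f 0)"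
    by (simp add: scaleR_add_left sum.distrib del: funpow.simps)
  also have "\<dots> = (\<Sum>j\<le>Suc n. real (Suc n choose j) *\<^sub>R (fdiff ^^ j) f 0)"
    using sum.atMost_shift[of "\<lambda>j. real (Suc n choose j) *\<^sub>R (fdiff ^^ j) f 0" "Suc n"]
    by (simp add: lessThan_Suc_atMost del: sum.atMost_Suc funpow.simps(2) binomial_Suc_Suc)
  finally show ?case .
qed

section \<open>Operator polynomials and interpolation\<close>

lemma op_polys_zero: "(\<lambda>z. 0) \<in> op_polys n"
  unfolding op_polys_def by (auto intro!: exI[of _ "\<lambda>_. 0"] simp: scaleC_zero_right)

lemma op_polys_add:
  assumes "p \<in> op_polys n" "q \<in> op_polys n"
  shows "(\<lambda>z. p z + q z) \<in> op_polys n"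
proof -
  obtain A B where "\<And>z. p z = (\<Sum>j\<le>n. z ^ j *\<^sub>C A j)" "\<And>z. q z = (\<Sum>j\<le>n. z ^ j *\<^sub>C B j)"
    using assms unfolding op_polys_def by blast
  then have "\<forall>z. p z + q z = (\<Sum>j\<le>n. z ^ j *\<^sub>C (A j + B j))"
    by (simp add: scaleC_add_right sum.distrib)
  then show ?thesis
    unfolding op_polys_def by (auto intro!: exI[of _ "\<lambda>j. A j + B j"])
qed

lemma op_polys_sum:
  assumes "finite I" "\<And>i. i \<in> I \<Longrightarrow> p i \<in> op_polys n"
  shows "(\<lambda>z. \<Sum>i\<in>I. p i z) \<in> op_polys n"
  using assms by (induction I rule: finite_induct) (simp_all add: op_polys_zero op_polys_add)

lemma op_polys_poly:
  assumes "degree q \<le> n"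
  shows "(\<lambda>z. poly q z *\<^sub>C A) \<in> op_polys n"
proof -
  have scaleC_sum: "(\<Sum>j\<in>I. a j) *\<^sub>C A = (\<Sum>j\<in>I. a j *\<^sub>C A)" for a and I :: "nat set"
    by (intro additive.sum additive.intro) (rule scaleC_add_left)
  have "poly q z = (\<Sum>j\<le>n. coeff q j * z ^ j)" for z
    unfolding poly_altdef using assms
    by (intro sum.mono_neutral_left) (auto simp: coeff_eq_0)
  then show ?thesis
    unfolding op_polys_def
    by (auto intro!: exI[of _ "\<lambda>j. coeff q j *\<^sub>C A"] simp: scaleC_sum scaleC_scaleC mult.commute)
qed

text \<open>This lets Newton's formula, valid at natural numbers, define a polynomial on the whole
  complex plane.\<close>

lemma gbinomial_eq_poly: "\<exists>q :: complex poly. degree q \<le> k \<and> (\<forall>z. z gchoose k = poly q z)"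
proof (intro exI conjI allI)
  let ?r = "\<Prod>i = 0..<k. [:- of_nat i, 1 :: complex:]"
  have "degree ?r \<le> (\<Sum>i = 0..<k. 1)"
    by (rule order.trans[OF degree_prod_sum_le]) (simp_all add: o_def)
  then show "degree (smult (inverse (fact k)) ?r) \<le> k"
    using degree_smult_le order.trans by fastforce
  show "z gchoose k = poly (smult (inverse (fact k)) ?r) z" for z
    by (simp add: gbinomial_prod_rev poly_prod field_simps)
qed

text \<open>Once the \<open>m\<close>-th difference vanishes so do all higher ones, and the Newton
  series stops at degree \<open>m - 1\<close>.\<close>

lemma op_polys_interpolate:
  assumes "1 \<le> m" and zero: "\<And>n. (fdiff ^^ m) f n = 0"
  shows "\<exists>p\<in>op_polys (m - 1). \<forall>n. p (of_nat n) = f n"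
proof
  let ?D = "\<lambda>j. (fdiff ^^ j) f 0"
  have D0: "?D j = 0" if "m \<le> j" for j
  proof -
    obtain i where "j = i + m" using \<open>m \<le> j\<close> by (metis add.commute le_Suc_ex)
    moreover have "(fdiff ^^ m) f = (\<lambda>_. 0)" using zero by auto
    ultimately show ?thesis
      by (simp add: funpow_add fdiff_power_zero)
  qed
  let ?p = "\<lambda>z. \<Sum>j<m. (z gchoose j) *\<^sub>C ?D j"
  show "?p \<in> op_polys (m - 1)"
  proof (rule op_polys_sum)
    fix j assume "j \<in> {..<m}"
    then have "j \<le> m - 1" by auto
    obtain q :: "complex poly" where "degree q \<le> j" "\<And>z. z gchoose j = poly q z"
      using gbinomial_eq_poly[of j] by blast
    with \<open>j \<le> m - 1\<close> show "(\<lambda>z. (z gchoose j) *\<^sub>C ?D j) \<in> op_polys (m - 1)"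
      by (simp add: op_polys_poly)
  qed simp
  show "\<forall>n. ?p (of_nat n) = f n"
  proof
    fix n
    have "f n = (\<Sum>j\<le>n. real (n choose j) *\<^sub>R ?D j)" by (rule newton_forward)
    also have "\<dots> = (\<Sum>j<m. real (n choose j) *\<^sub>R ?D j)"
      \<comment> \<open>Terms with \<open>j > n\<close> vanish through the binomial coefficient,
        those with \<open>j \<ge> m\<close> through \<open>D0\<close>.\<close>
      by (rule sum.mono_neutral_cong) (auto simp: D0 binomial_eq_0 not_less)
    also have "\<dots> = ?p (of_nat n)"
      by (simp flip: binomial_gbinomial scaleC_of_real)
    finally show "?p (of_nat n) = f n" ..
  qed
qed

text \<open>Pairing with vectors reduces the claim to scalar monomials, where
  \<open>fdiff_power_monomial\<close> applies.\<close>

lemma fdiff_power_op_poly: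
  assumes "p \<in> op_polys (m - 1)" "1 \<le> m"
  shows "(fdiff ^^ m) (\<lambda>n. cinner (p (of_nat n) x) y) n = 0"
proof -
  obtain A where A: "\<And>z. p z = (\<Sum>j\<le>m - 1. z ^ j *\<^sub>C A j)"
    using assms unfolding op_polys_def by blast
  let ?c = "\<lambda>j. cinner (A j x) y"
  have "(fdiff ^^ m) (\<lambda>n. cinner (p (of_nat n) x) y) n
      = (\<Sum>k\<le>m. \<Sum>j\<le>m - 1. ?c j * (m_coeff m k *\<^sub>R of_nat (n + k) ^ j))"
    by (simp add: fdiff_power_sum A bop.sum_left cinner.sum_left scaleC_bop_apply
        cinner_scaleC_left scaleR_sum_right mult_ac)
  also have "\<dots> = (\<Sum>j\<le>m - 1. ?c j * (\<Sum>k\<le>m. m_coeff m k *\<^sub>R of_nat (n + k) ^ j))"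
    by (subst sum.swap) (simp only: sum_distrib_left)
  also have "\<dots> = (\<Sum>j\<le>m - 1. ?c j * (fdiff ^^ m) (\<lambda>n. of_nat n ^ j) n)"
    by (simp only: fdiff_power_sum)
  also have "\<dots> = 0"
    using \<open>1 \<le> m\<close> by (intro sum.neutral) (auto simp: fdiff_power_monomial)
  finally show ?thesis .
qed

section \<open>The characterisation\<close>

lemma cinner_abs_op_power2:
  "cinner (((abs_op T)\<^sup>2) x) x = complex_of_real ((norm (bop_apply T x))\<^sup>2)"
  by (simp add: abs_op_power2 times_bop_apply cinner_adj_left cinner_self)

section \<open>The norm of a shift\<close>

lemma norm_shift_le:
  assumes S: "is_weighted_shift W S" and "0 \<le> r"
    and W: "\<And>n x. norm (bop_apply (W (Suc n)) x) \<le> r * norm x"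
  shows "norm S \<le> r"
proof (rule bop_norm_le)
  fix h
  have summ: "summable (\<lambda>n. (norm (ell2_nth (S h) (Suc n)))\<^sup>2)"
    using ell2_summable[of "S h"] by (simp add: summable_Suc_iff[of "\<lambda>n. (norm (ell2_nth (S h) n))\<^sup>2"])
  have "(norm (S h))\<^sup>2 = (\<Sum>n. (norm (ell2_nth (S h) (Suc n)))\<^sup>2)"
    using suminf_split_head[OF ell2_summable, of "S h"] S
    by (simp add: power2_norm_ell2 is_weighted_shift_def)
  also have "\<dots> \<le> (\<Sum>n. r\<^sup>2 * (norm (ell2_nth h n))\<^sup>2)"
  proof (rule suminf_le[OF _ summ summable_mult[OF ell2_summable]])
    fix n
    have "norm (ell2_nth (S h) (Suc n)) \<le> r * norm (ell2_nth h n)"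
      using S W by (simp add: is_weighted_shift_def)
    then show "(norm (ell2_nth (S h) (Suc n)))\<^sup>2 \<le> r\<^sup>2 * (norm (ell2_nth h n))\<^sup>2"
      by (metis norm_ge_zero power_mono power_mult_distrib)
  qed
  also have "\<dots> = (r * norm h)\<^sup>2"
    by (simp add: suminf_mult ell2_summable power2_norm_ell2 power_mult_distrib)
  finally show "norm (S h) \<le> r * norm h"
    by (rule power2_le_imp_le) (simp add: \<open>0 \<le> r\<close>)
qed (rule \<open>0 \<le> r\<close>)

text \<open>The quotients are attained on sequences supported at one index. Conversely they control
  each weight on all of the space, since \<open>shift_prod W n\<close> is onto. On the zero space
  both sides are 0, the supremum being over the empty set.\<close>

lemma norm_shift_eq_SUP:
  fixes W :: "nat \<Rightarrow> 'h::complex_hilbert bop"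
  assumes inv: "\<And>j. j \<ge> 1 \<Longrightarrow> invertible_op (W j)" and S: "is_weighted_shift W S"
  shows "ennreal ((norm S)\<^sup>2) = (SUP (n, h)\<in>UNIV \<times> {h. h \<noteq> 0}.
    ennreal ((norm (shift_prod W (Suc n) h))\<^sup>2 / (norm (shift_prod W n h))\<^sup>2))"
  (is "_ = ?M")
proof (rule antisym)
  have nz: "shift_prod W n h \<noteq> 0" if "h \<noteq> 0" for n h
    by (rule shift_prod_nonzero) (use inv that in auto)
  have le: "ennreal ((norm (shift_prod W (Suc n) h))\<^sup>2 / (norm (shift_prod W n h))\<^sup>2)
      \<le> ennreal ((norm S)\<^sup>2)" if "h \<noteq> 0" for n h
  proof -
    have "norm (shift_prod W (Suc n) h) = norm (S (ell2_single n (shift_prod W n h)))"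
      by (simp add: shift_ell2_single[OF S] norm_ell2_single times_bop_apply)
    also have "\<dots> \<le> norm S * norm (shift_prod W n h)"
      using norm_bop_apply[of S] by (metis norm_ell2_single)
    finally have "(norm (shift_prod W (Suc n) h))\<^sup>2 \<le> (norm S)\<^sup>2 * (norm (shift_prod W n h))\<^sup>2"
      by (metis norm_ge_zero power_mono power_mult_distrib)
    then show ?thesis
      using nz[OF that, of n] by (intro ennreal_leI) (simp add: divide_le_eq del: shift_prod.simps)
  qed
  then show M_le: "?M \<le> ennreal ((norm S)\<^sup>2)"
    by (intro SUP_least) (auto simp del: shift_prod.simps)
  \<comment> \<open>Being below \<open>(norm S)\<^sup>2\<close>, the supremum is a finite real
    \<open>c\<close>, so \<open>sqrt c\<close> can serve as a common bound for the weights.\<close>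
  have "\<exists>c\<ge>0. x = ennreal c" if "x \<le> ennreal r" for x r
    using that by (cases x) (auto simp: top_unique)
  from this[OF M_le] obtain c where c: "0 \<le> c" "?M = ennreal c" by blast
  have "norm (W (Suc n) x) \<le> sqrt c * norm x" for n x
  proof (cases "x = 0")
    case False
    have "\<exists>h. shift_prod W n h = x"
      by (rule shift_prod_surj) (use inv in auto)
    then obtain h where h: "shift_prod W n h = x" by blast
    with False have "h \<noteq> 0" by (auto simp: bop_zero)
    then have "ennreal ((norm (shift_prod W (Suc n) h))\<^sup>2 / (norm (shift_prod W n h))\<^sup>2) \<le> ?M"
      by (intro SUP_upper2[of "(n, h)"]) auto
    then have "(norm (W (Suc n) x))\<^sup>2 / (norm x)\<^sup>2 \<le> c"
      using c by (simp add: h times_bop_apply)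
    then have "(norm (W (Suc n) x))\<^sup>2 \<le> (sqrt c * norm x)\<^sup>2"
      using False c by (simp add: divide_le_eq power_mult_distrib)
    then show ?thesis
      by (rule power2_le_imp_le) (simp add: c)
  qed (simp add: bop_zero)
  then have "norm S \<le> sqrt c"
    using norm_shift_le[OF S, of "sqrt c"] c by simp
  then have "(norm S)\<^sup>2 \<le> c"
    using c by (metis norm_ge_zero power_mono real_sqrt_pow2)
  then show "ennreal ((norm S)\<^sup>2) \<le> ?M"
    unfolding c(2) by (rule ennreal_leI)
qed

text \<open>The scalar identities say that the quadratic form of the \<open>m\<close>-th difference
  of \<open>n \<mapsto> (abs_op (shift_prod W n))\<^sup>2\<close> is zero, hence by polarisation the
  difference itself. The index \<open>n = 0\<close> is included so that Newton's formula can start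
  there.\<close>

lemma m_isometric_shift_iff_op_poly:
  fixes W :: "nat \<Rightarrow> 'h::complex_hilbert bop"
  assumes m: "m \<ge> 1" and inv: "\<And>j. j \<ge> 1 \<Longrightarrow> invertible_op (W j)" and S: "is_weighted_shift W S"
  shows "m_isometric m S \<longleftrightarrow>
    (\<exists>p\<in>op_polys (m - 1). \<forall>n. p (of_nat n) = (abs_op (shift_prod W n))\<^sup>2)"
proof -
  let ?f = "\<lambda>n. (abs_op (shift_prod W n))\<^sup>2"
  have diff: "cinner ((fdiff ^^ m) ?f n x) x
      = complex_of_real (\<Sum>k\<le>m. m_coeff m k * (norm (shift_prod W (n + k) x))\<^sup>2)" for n x
    by (simp add: fdiff_power_sum bop.sum_left cinner.sum_left bop.scaleR_left cinner.scaleR_left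
        cinner_abs_op_power2 scaleR_conv_of_real)
  have iso: "m_isometric m S \<longleftrightarrow> (\<forall>x n. cinner ((fdiff ^^ m) ?f n x) x = 0)"
    unfolding diff of_real_eq_0_iff by (rule m_isometric_shift_iff[OF _ S]) (rule inv)
  show ?thesis
  proof
    assume "m_isometric m S"
    then have "(fdiff ^^ m) ?f n = 0" for n
      unfolding iso by (intro bop_eq_zeroI) blast
    then show "\<exists>p\<in>op_polys (m - 1). \<forall>n. p (of_nat n) = ?f n"
      by (rule op_polys_interpolate[OF m])
  next
    assume "\<exists>p\<in>op_polys (m - 1). \<forall>n. p (of_nat n) = ?f n"
    then obtain p where p: "p \<in> op_polys (m - 1)" "\<And>n. p (of_nat n) = ?f n" by blast
    have "cinner ((fdiff ^^ m) ?f n x) x = (fdiff ^^ m) (\<lambda>n. cinner (p (of_nat n) x) x) n" for n x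
      by (simp add: p(2) fdiff_power_sum bop.sum_left cinner.sum_left bop.scaleR_left cinner.scaleR_left)
    then show "m_isometric m S"
      unfolding iso using fdiff_power_op_poly[OF p(1) m] by simp
  qed
qed

theorem theorem3p1:
  fixes W :: "nat \<Rightarrow> 'h::complex_hilbert bop" and S :: "'h ell2 bop" and m :: nat
  assumes "m \<ge> 1"
    and "bounded (W ` {1..})"
    and "\<And>j. j \<ge> 1 \<Longrightarrow> invertible_op (W j)"
    and "is_weighted_shift W S"
  shows "(m_isometric m S \<longleftrightarrow>
      (\<forall>x. x \<noteq> 0 \<longrightarrow> m_isometric m (scalar_weighted_shift (vector_weight W x)))) \<and>
    (m_isometric m S \<longleftrightarrow>
      (\<exists>p\<in>op_polys (m - 1). p 0 = 1 \<and>
        (\<forall>n\<ge>1. p (of_nat n) = (abs_op (shift_prod W n))\<^sup>2))) \<and>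
    (\<forall>p\<in>op_polys (m - 1). p 0 = 1 \<and>
        (\<forall>n\<ge>1. p (of_nat n) = (abs_op (shift_prod W n))\<^sup>2) \<longrightarrow>
      ennreal ((norm S)\<^sup>2) =
        (SUP (n :: nat, h)\<in>UNIV \<times> {h. h \<noteq> 0}.
          ennreal (Re (cinner (p (of_nat (n + 1)) h) h / cinner (p (of_nat n) h) h))))"
proof (intro conjI ballI impI)
  note inv = assms(3) and S = assms(4)
  \<comment> \<open>The empty product turns \<open>p 0 = 1\<close> into the interpolation condition
    at \<open>n = 0\<close>.\<close>
  have P0: "(abs_op (shift_prod W 0))\<^sup>2 = 1"
    by (rule bop_eqI, rule cinner_right_eqI)
      (simp add: abs_op_power2 times_bop_apply one_bop_apply cinner_adj_right)
  have interp_iff: "p 0 = 1 \<and> (\<forall>n\<ge>1. p (of_nat n) = (abs_op (shift_prod W n))\<^sup>2) \<longleftrightarrow>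
      (\<forall>n. p (of_nat n) = (abs_op (shift_prod W n))\<^sup>2)" for p :: "complex \<Rightarrow> 'h bop"
  proof
    assume p: "p 0 = 1 \<and> (\<forall>n\<ge>1. p (of_nat n) = (abs_op (shift_prod W n))\<^sup>2)"
    show "\<forall>n. p (of_nat n) = (abs_op (shift_prod W n))\<^sup>2"
    proof
      fix n
      show "p (of_nat n) = (abs_op (shift_prod W n))\<^sup>2"
        by (cases "n = 0") (use p P0 in auto)
    qed
  next
    assume "\<forall>n. p (of_nat n) = (abs_op (shift_prod W n))\<^sup>2"
    then show "p 0 = 1 \<and> (\<forall>n\<ge>1. p (of_nat n) = (abs_op (shift_prod W n))\<^sup>2)"
      using P0 by (metis of_nat_0)
  qed
  have "m_isometric m S \<longleftrightarrow>
      (\<forall>x n. (\<Sum>k\<le>m. m_coeff m k * (norm (shift_prod W (n + k) x))\<^sup>2) = 0)"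
    by (rule m_isometric_shift_iff[OF _ S]) (rule inv)
  \<comment> \<open>For \<open>x = 0\<close> every term of the sum is zero, so restricting to
    nonzero vectors loses nothing.\<close>
  also have "\<dots> \<longleftrightarrow>
      (\<forall>x. x \<noteq> 0 \<longrightarrow> (\<forall>n. (\<Sum>k\<le>m. m_coeff m k * (norm (shift_prod W (n + k) x))\<^sup>2) = 0))"
    by (auto simp: bop_zero) (metis (no_types, lifting) bop_zero mult_zero_right norm_zero
        power_zero_numeral sum.neutral)
  also have "\<dots> \<longleftrightarrow> (\<forall>x. x \<noteq> 0 \<longrightarrow> m_isometric m (scalar_weighted_shift (vector_weight W x)))"
    using m_isometric_vector_weight_iff[of W _ m] assms(2) inv by auto
  finally show "m_isometric m S \<longleftrightarrow>
      (\<forall>x. x \<noteq> 0 \<longrightarrow> m_isometric m (scalar_weighted_shift (vector_weight W x)))" .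
  show "m_isometric m S \<longleftrightarrow> (\<exists>p\<in>op_polys (m - 1). p 0 = 1 \<and>
      (\<forall>n\<ge>1. p (of_nat n) = (abs_op (shift_prod W n))\<^sup>2))"
    unfolding interp_iff by (rule m_isometric_shift_iff_op_poly[OF assms(1) _ S]) (rule inv)
  fix p :: "complex \<Rightarrow> 'h bop"
  assume "p 0 = 1 \<and> (\<forall>n\<ge>1. p (of_nat n) = (abs_op (shift_prod W n))\<^sup>2)"
  then have p: "p (of_nat n) = (abs_op (shift_prod W n))\<^sup>2" for n
    unfolding interp_iff by blast
  \<comment> \<open>Both inner products are squared norms, so the complex quotient is real and
    \<open>Re\<close> returns it unchanged.\<close>
  have "Re (cinner (p (of_nat (n + 1)) h) h / cinner (p (of_nat n) h) h)
      = (norm (shift_prod W (Suc n) h))\<^sup>2 / (norm (shift_prod W n h))\<^sup>2" for n h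
    unfolding p cinner_abs_op_power2 of_real_divide[symmetric] Re_complex_of_real by simp
  then show "ennreal ((norm S)\<^sup>2) = (SUP (n :: nat, h)\<in>UNIV \<times> {h. h \<noteq> 0}.
      ennreal (Re (cinner (p (of_nat (n + 1)) h) h / cinner (p (of_nat n) h) h)))"
    using norm_shift_eq_SUP[OF _ S] inv by simp
qed

end
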